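(* Let $(p_n(x))_{n\ge0}$ be a sequence of polynomials in $\mathbb C[x]$ of binomial type, and put $p_n(x)=0$ for $n<0$. Then there exists a unique logarithmic sequence $p_n^\alpha(x)$ (indexed by $n\in\mathbb Z$ and vectors $\alpha$ of integers with finite support) which (i) extends $p_n(x)$: $p_n^{(0)}(x)=p_n(x)$ for all integers $n$; (ii) obeys an analog of the binomial theorem: $$p_n^\alpha(x+a)=\sum_{k=0}^{\infty}\frac{\lfloor n\rceil!}{\lfloor k\rceil!\,\lfloor n-k\rceil!}\,p_k(a)\,p_{n-k}^\alpha(x)$$ for all $\alpha$, all integers $n$ and all constants $a$; (iii) is invariant under the skip operators: $\mathrm{skip}_{\alpha\beta}\,p_n^\gamma(x)=\delta_{\beta\gamma}\,p_n^\alpha(x)$ for all $\alpha,\gamma$, all $\beta\ne(0)$ and all integers $n$.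
   Context: A sequence of polynomials $(p_n)_{n\ge0}$ with $\deg p_n=n$ is of binomial type if $p_n(x+a)=\sum_{k=0}^n\binom nkp_k(a)p_{n-k}(x)$ for all $a$ and $n\ge0$. Vectors $\alpha=(\alpha_1,\alpha_2,\dots)$ are sequences of integers with only finitely many nonzero entries; $(0)$ is the zero vector. For an integer $n$ put $\ell^{(n),\alpha}=x^n(\log x)^{\alpha_1}(\log\log x)^{\alpha_2}\cdots$, regarded as linearly independent formal monomials. The derivative acts termwise on (possibly infinite) formal sums by $$D\ell^{(n),\alpha}=n\,\ell^{(n-1),\alpha}+\sum_{k\ge1}\alpha_k\,\ell^{(n-1),(\alpha_1-1,\dots,\alpha_k-1,\alpha_{k+1},\alpha_{k+2},\dots)}.$$ Roman factorial: $\lfloor n\rceil!=n!$ for $n\ge0$ and $\lfloor n\rceil!=(-1)^{n-1}/(-n-1)!$ for $n<0$; $\lfloor n\rceil=n$ for $n\neq0$ and $\lfloor 0\rceil=1$. The harmonic logarithm of degree $n$ and order $\alpha$ is the formal series $$\lambda_n^\alpha(x)=\sum_{\rho}\lfloor n\rceil!\,s(-n,\rho_1)\Bigl[\prod_{i\ge1}e_{\rho_i-\rho_{i+1}}(\alpha_i,\alpha_i-1,\dots,\alpha_i-\rho_i+1)\Bigr]\ell^{(n),\alpha-\rho},$$ over all weakly decreasing sequences $\rho=(\rho_1,\rho_2,\dots)$ of nonnegative integers with finitely many nonzero terms. Here $s(m,k)$ ($m\in\mathbb Z$, $k\ge0$) is the coefficient of $y^k$ in the Taylor expansion at $0$ of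 $\Gamma(y+1)/\Gamma(y-m+1)$, and $e_k$ is the $k$-th elementary symmetric function of the listed arguments. In particular $\lambda_n^{(0)}=x^n$ for $n\ge0$ and $\lambda_n^{(0)}=0$ for $n<0$. $\mathcal L^\alpha$ is the complex vector space of all formal series $\sum_{n\le N}c_n\lambda_n^\alpha(x)$, $N\in\mathbb Z$, $c_n\in\mathbb C$. One has $D\lambda_n^\alpha=\lfloor n\rceil\lambda_{n-1}^\alpha$. For $a\in\mathbb C$ the shift is $E^a=\sum_{k\ge0}a^kD^k/k!$, and $p(x+a)$ means $E^ap(x)$. For $\beta\ne(0)$, $\mathrm{skip}_{\alpha\beta}$ is the linear operator defined termwise by $\mathrm{skip}_{\alpha\beta}\lambda_n^\gamma=\delta_{\beta\gamma}\lambda_n^\alpha$. A logarithmic sequence is a family $p_n^\alpha(x)$ with $p_n^\alpha(x)=\sum_{k\le n}c_k\lambda_k^\alpha(x)$, $c_n\ne0$ (coefficients depending on $n,\alpha$); for $\alpha=(0)$ this means $p_n^{(0)}$ is a polynomial of degree $n$ for $n\ge0$ and $p_n^{(0)}=0$ for $n<0$. *)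

theory Defs
  imports "HOL-Complex_Analysis.Complex_Analysis"
    "HOL-Computational_Algebra.Polynomial"
    "HOL-Library.Poly_Mapping"
begin

definition binomial_type :: "(nat \<Rightarrow> complex poly) \<Rightarrow> bool" where
  "binomial_type q \<longleftrightarrow>
     (\<forall>n. q n \<noteq> 0 \<and> degree (q n) = n) \<and>
     (\<forall>n a. pcompose (q n) [:a, 1:] =
        (\<Sum>k\<le>n. smult (of_nat (n choose k) * poly (q k) a) (q (n - k))))"

(* The vector (alpha_1, alpha_2, ...) is indexed from 0: alpha_(i+1) is "Poly_Mapping.lookup \<alpha> i". *)
type_synonym logvec = "nat \<Rightarrow>\<^sub>0 int"

(* A formal sum of the monomials l^{(n),alpha} is its family of coefficients. *)
type_synonym logser = "int \<Rightarrow> logvec \<Rightarrow> complex"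

(* Formal sum of the series c i * F i, coefficient by coefficient.  It is meaningful when every
   monomial receives only finitely many nonzero contributions; a coefficient receiving infinitely
   many is set to 0 by Sum_any, which never happens for the series considered below. *)
definition formal_sum :: "('i \<Rightarrow> complex) \<Rightarrow> ('i \<Rightarrow> logser) \<Rightarrow> logser" where
  "formal_sum c F = (\<lambda>m \<beta>. Sum_any (\<lambda>i. c i * F i m \<beta>))"

definition zero_ser :: logser where
  "zero_ser = (\<lambda>m \<beta>. 0)"

definition ell :: "int \<Rightarrow> logvec \<Rightarrow> logser" where
  "ell n \<alpha> = (\<lambda>m \<beta>. if m = n \<and> \<beta> = \<alpha> then 1 else 0)"

definition poly_ser :: "complex poly \<Rightarrow> logser" where
  "poly_ser q = formal_sum (coeff q) (\<lambda>k. ell (int k) 0)"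

(* (1, ..., 1, 0, 0, ...) with k ones *)
definition ones :: "nat \<Rightarrow> logvec" where
  "ones k = (\<Sum>i<k. Poly_Mapping.single i 1)"

definition D_ell :: "int \<Rightarrow> logvec \<Rightarrow> logser" where
  "D_ell n \<alpha> = (\<lambda>m \<beta>. of_int n * ell (n - 1) \<alpha> m \<beta> +
     (\<Sum>k\<in>Poly_Mapping.keys \<alpha>.
        of_int (Poly_Mapping.lookup \<alpha> k) * ell (n - 1) (\<alpha> - ones (Suc k)) m \<beta>))"

definition D_ser :: "logser \<Rightarrow> logser" where
  "D_ser f = formal_sum (\<lambda>(n, \<alpha>). f n \<alpha>) (\<lambda>(n, \<alpha>). D_ell n \<alpha>)"

definition shift_ser :: "complex \<Rightarrow> logser \<Rightarrow> logser" where
  "shift_ser a f = formal_sum (\<lambda>k. a ^ k / fact k) (\<lambda>k. (D_ser ^^ k) f)"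

definition roman_fact :: "int \<Rightarrow> complex" where
  "roman_fact n =
     (if n \<ge> 0 then fact (nat n) else (- 1) powi (n - 1) / fact (nat (- n - 1)))"

(* Gamma vanishes at its poles in HOL-Analysis, so the quotient agrees with its analytic
   continuation also at y = 0. *)
definition roman_stirling :: "int \<Rightarrow> nat \<Rightarrow> complex" where
  "roman_stirling m k =
     fps_nth (fps_expansion (\<lambda>y. Gamma (y + 1) / Gamma (y - of_int m + 1)) 0) k"

(* e_k(x_0, ..., x_(r-1)) *)
definition elem_sym :: "nat \<Rightarrow> nat \<Rightarrow> (nat \<Rightarrow> int) \<Rightarrow> int" where
  "elem_sym k r x = (\<Sum>X | X \<subseteq> {..<r} \<and> card X = k. \<Prod>j\<in>X. x j)"

definition decreasing_vec :: "logvec \<Rightarrow> bool" where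
  "decreasing_vec \<rho> \<longleftrightarrow> (\<forall>i. 0 \<le> Poly_Mapping.lookup \<rho> i \<and> Poly_Mapping.lookup \<rho> (Suc i) \<le> Poly_Mapping.lookup \<rho> i)"

(* All but finitely many factors of the product are e_0() = 1. *)
definition harmonic_coeff :: "int \<Rightarrow> logvec \<Rightarrow> logvec \<Rightarrow> complex" where
  "harmonic_coeff n \<alpha> \<rho> =
     (let a = Poly_Mapping.lookup \<alpha>; r = Poly_Mapping.lookup \<rho> in
        roman_fact n * roman_stirling (- n) (nat (r 0)) *
        of_int (Prod_any (\<lambda>i. elem_sym (nat (r i - r (Suc i))) (nat (r i)) (\<lambda>j. a i - int j))))"

definition harmonic_log :: "int \<Rightarrow> logvec \<Rightarrow> logser" where
  "harmonic_log n \<alpha> =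
     formal_sum (\<lambda>\<rho>. if decreasing_vec \<rho> then harmonic_coeff n \<alpha> \<rho> else 0)
                (\<lambda>\<rho>. ell n (\<alpha> - \<rho>))"

definition degree_bounded :: "(int \<Rightarrow> complex) \<Rightarrow> bool" where
  "degree_bounded c \<longleftrightarrow> (\<exists>N. \<forall>n>N. c n = 0)"

(* The skip operator on the sum of the spaces L^gamma: an element is written as
   sum_{n,gamma} c_{gamma,n} lambda_n^gamma with finitely many orders gamma and degrees bounded
   above for each of them, and the operator acts termwise.  For beta = (0) it would not be well
   defined, since lambda_n^(0) = 0 for n < 0. *)
definition skip_ser :: "logvec \<Rightarrow> logvec \<Rightarrow> logser \<Rightarrow> logser" where
  "skip_ser \<alpha> \<beta> f = (THE g. \<exists>c :: logvec \<Rightarrow> int \<Rightarrow> complex.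
      finite {\<gamma>. \<exists>n. c \<gamma> n \<noteq> 0} \<and> (\<forall>\<gamma>. degree_bounded (c \<gamma>)) \<and>
      f = formal_sum (\<lambda>(n, \<gamma>). c \<gamma> n) (\<lambda>(n, \<gamma>). harmonic_log n \<gamma>) \<and>
      g = formal_sum (\<lambda>(n, \<gamma>). c \<gamma> n)
            (\<lambda>(n, \<gamma>). if \<beta> = \<gamma> then harmonic_log n \<alpha> else zero_ser))"

(* For alpha = (0) this says that p n 0 is a polynomial of degree n if n >= 0, and zero if n < 0,
   because harmonic_log k 0 is x^k for k >= 0 and zero for k < 0. *)
definition logarithmic_sequence :: "(int \<Rightarrow> logvec \<Rightarrow> logser) \<Rightarrow> bool" where
  "logarithmic_sequence p \<longleftrightarrow>
     (\<forall>n \<alpha>. \<exists>c. c n \<noteq> 0 \<and> (\<forall>k>n. c k = 0) \<and>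
        p n \<alpha> = formal_sum c (\<lambda>k. harmonic_log k \<alpha>))"

end

theory Submission
  imports Defs
begin

text \<open>
  Let \<open>g(t) = \<Sum>\<^sub>k q\<^sub>k'(0) t\<^sup>k / k!\<close>, so that \<open>exp (x g(t))\<close> is the exponential generating function of
  \<open>q\<close>.  Thus the coefficient of \<open>x\<^sup>k / k!\<close> in \<open>q\<^sub>n(x) / n!\<close> is the coefficient of \<open>t\<^sup>n\<close> in \<open>g\<^sup>k\<close>.
  As \<open>g\<close> has order 1, its powers make sense as Laurent series for all integers \<open>k\<close>, and the
  extension is \<open>p\<^sub>n = \<lfloor>n\<rceil>! \<Sum>\<^sub>k [t\<^sup>n] g\<^sup>k \<cdot> \<lambda>\<^sub>k / \<lfloor>k\<rceil>!\<close> for every order.  Since \<open>D\<close> lowers the index of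
  \<open>\<lambda>\<^sub>k / \<lfloor>k\<rceil>!\<close> by one, the binomial law amounts to \<open>g\<^sup>k\<^sup>+\<^sup>i = g\<^sup>i g\<^sup>k\<close>.

  Conversely, skip invariance forces one coefficient array \<open>c\<^sub>n\<^sub>,\<^sub>k\<close> for all orders, its entries with
  \<open>k \<ge> 0\<close> are those of \<open>q\<close>, and the linear terms in \<open>a\<close> of the binomial law give a recurrence that
  determines the entries with \<open>k < 0\<close>, as the linear coefficient of \<open>g\<close> is nonzero.  Both this and
  the skip operators being well defined rest on the linear independence of the harmonic
  logarithms of a given degree, which is seen from their lexicographically leading monomials.
\<close>

subsection \<open>Elementary symmetric products\<close>

lemma Sum_any_singleton:
  assumes "\<And>i. i \<noteq> a \<Longrightarrow> f i = 0"
  shows "Sum_any f = f a"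
proof -
  have "Sum_any f = sum f {a}"
    by (rule Sum_any.expand_superset) (use assms in auto)
  then show ?thesis by simp
qed

lemma lookup_ones: "Poly_Mapping.lookup (ones k) i = (if i < k then 1 else 0)"
  by (simp add: ones_def lookup_sum lookup_single when_def sum.delta)

lemma ones_eq_iff [simp]: "ones j = ones k \<longleftrightarrow> j = k"
proof
  assume "ones j = ones k"
  then have "Poly_Mapping.lookup (ones j) i = Poly_Mapping.lookup (ones k) i" for i by simp
  then have "i < j \<longleftrightarrow> i < k" for i
    by (metis lookup_ones zero_neq_one)
  then show "j = k" by (meson linorder_neqE_nat less_irrefl)
qed simp

lemma ones_Suc_neq_0 [simp]: "ones (Suc k) \<noteq> 0"
  using lookup_ones[of "Suc k" k] by auto

lemma elem_sym_0 [simp]: "elem_sym 0 r x = 1"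
proof -
  have "{X. X \<subseteq> {..<r} \<and> card X = 0} = {{}}"
    by (auto dest: finite_subset)
  then show ?thesis by (simp add: elem_sym_def)
qed

lemma elem_sym_eq_0:
  assumes "r < k"
  shows "elem_sym k r x = 0"
proof -
  have "{X. X \<subseteq> {..<r} \<and> card X = k} = {}"
    using assms by (auto dest: card_mono[OF finite_lessThan])
  then show ?thesis by (simp only: elem_sym_def sum.empty)
qed

text \<open>Split the subsets by whether they contain the largest index \<open>r\<close>. The last
  argument is singled out because it is the one that is lost when an entry of \<open>\<rho>\<close>
  drops by one.\<close>

lemma elem_sym_Suc_Suc:
  "elem_sym (Suc k) (Suc r) x = elem_sym (Suc k) r x + x r * elem_sym k r x"
proof -
  let ?S = "\<lambda>k. {X. X \<subseteq> {..<r} \<and> card X = k}"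
  have fin: "finite (?S k)" for k
    by (rule finite_subset[of _ "Pow {..<r}"]) auto
  have split: "{X. X \<subseteq> {..<Suc r} \<and> card X = Suc k} = ?S (Suc k) \<union> insert r ` ?S k"
  proof (intro equalityI subsetI)
    fix X assume X: "X \<in> {X. X \<subseteq> {..<Suc r} \<and> card X = Suc k}"
    show "X \<in> ?S (Suc k) \<union> insert r ` ?S k"
    proof (cases "r \<in> X")
      case True
      with X have "X - {r} \<in> ?S k" "X = insert r (X - {r})"
        using finite_subset[of X "{..<Suc r}"] by (auto simp: less_Suc_eq)
      then show ?thesis by blast
    next
      case False
      with X show ?thesis by (auto simp: less_Suc_eq)
    qed
  next
    fix X assume "X \<in> ?S (Suc k) \<union> insert r ` ?S k"
    moreover have "card (insert r Y) = Suc (card Y)" if "Y \<subseteq> {..<r}" for Y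
      using that finite_subset[of Y "{..<r}"] by (subst card_insert_disjoint) auto
    ultimately show "X \<in> {X. X \<subseteq> {..<Suc r} \<and> card X = Suc k}"
      by auto
  qed
  have "inj_on (insert r) (?S k)"
    by (rule inj_onI) (auto simp: insert_ident)
  moreover have "(\<Prod>j\<in>insert r X. x j) = x r * (\<Prod>j\<in>X. x j)" if "X \<in> ?S k" for X
    using that finite_subset[of X "{..<r}"] by (subst prod.insert) auto
  ultimately have "(\<Sum>X\<in>insert r ` ?S k. \<Prod>j\<in>X. x j) = x r * elem_sym k r x"
    by (simp add: sum.reindex elem_sym_def sum_distrib_left)
  moreover have "?S (Suc k) \<inter> insert r ` ?S k = {}" by auto
  ultimately show ?thesis
    by (simp add: elem_sym_def[of "Suc k" "Suc r"] split sum.union_disjoint fin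
        elem_sym_def[of "Suc k" r])
qed

text \<open>The factors of \<open>A\<close> are exchanged for those of \<open>B\<close> one at a
  time from the left; each summand is the change caused by one exchange.\<close>

lemma prod_diff_telescope:
  fixes A B :: "nat \<Rightarrow> 'a::comm_ring_1"
  shows "(\<Prod>i<N. A i) - (\<Prod>i<N. B i) =
    (\<Sum>k<N. (\<Prod>i<k. B i) * (A k - B k) * (\<Prod>i\<in>{Suc k..<N}. A i))"
proof (induction N)
  case (Suc N)
  have "(\<Sum>k<Suc N. (\<Prod>i<k. B i) * (A k - B k) * (\<Prod>i\<in>{Suc k..<Suc N}. A i)) =
      (\<Sum>k<N. (\<Prod>i<k. B i) * (A k - B k) * (\<Prod>i\<in>{Suc k..<N}. A i)) * A N
      + (\<Prod>i<N. B i) * (A N - B N)"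
    by (simp add: sum_distrib_left sum_distrib_right mult_ac)
  also have "\<dots> = (\<Prod>i<Suc N. A i) - (\<Prod>i<Suc N. B i)"
    unfolding Suc.IH[symmetric] by (simp add: algebra_simps)
  finally show ?case by simp
qed simp

text \<open>The factor of \<open>harmonic_coeff\<close> that is independent of the degree, isolated
  because it obeys a recurrence in \<open>\<rho>\<close> of its own.\<close>

definition esym_prod :: "logvec \<Rightarrow> logvec \<Rightarrow> int" where
  "esym_prod \<alpha> \<rho> = Prod_any (\<lambda>i. elem_sym
     (nat (Poly_Mapping.lookup \<rho> i - Poly_Mapping.lookup \<rho> (Suc i)))
     (nat (Poly_Mapping.lookup \<rho> i)) (\<lambda>j. Poly_Mapping.lookup \<alpha> i - int j))"

lemma esym_prod_eq:
  assumes "\<And>i. i \<ge> N \<Longrightarrow> Poly_Mapping.lookup \<rho> i = 0"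
  shows "esym_prod \<alpha> \<rho> = (\<Prod>i<N. elem_sym
     (nat (Poly_Mapping.lookup \<rho> i - Poly_Mapping.lookup \<rho> (Suc i)))
     (nat (Poly_Mapping.lookup \<rho> i)) (\<lambda>j. Poly_Mapping.lookup \<alpha> i - int j))"
  unfolding esym_prod_def
proof (rule Prod_any.expand_superset, goal_cases)
  case 2
  show ?case
  proof (rule subsetI)
    fix i assume i: "i \<in> {i. elem_sym
     (nat (Poly_Mapping.lookup \<rho> i - Poly_Mapping.lookup \<rho> (Suc i)))
     (nat (Poly_Mapping.lookup \<rho> i)) (\<lambda>j. Poly_Mapping.lookup \<alpha> i - int j) \<noteq> 1}"
    show "i \<in> {..<N}"
      using i assms[of i] assms[of "Suc i"] by (cases "i < N") auto
  qed
qed simp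

lemma esym_prod_0 [simp]: "esym_prod \<alpha> 0 = 1"
  by (subst esym_prod_eq[of 0]) auto

section \<open>Weakly decreasing index vectors\<close>

lemma decreasing_vec_antimono:
  assumes "decreasing_vec \<rho>" "i \<le> j"
  shows "Poly_Mapping.lookup \<rho> j \<le> Poly_Mapping.lookup \<rho> i"
  using \<open>i \<le> j\<close>
proof (induction j rule: dec_induct)
  case (step j)
  moreover have "Poly_Mapping.lookup \<rho> (Suc j) \<le> Poly_Mapping.lookup \<rho> j"
    using assms(1) unfolding decreasing_vec_def by blast
  ultimately show ?case by linarith
qed simp

lemma decreasing_vec_keys:
  assumes "decreasing_vec \<rho>"
  obtains N where "Poly_Mapping.keys \<rho> = {..<N}"
proof -
  define N where "N = (LEAST i. Poly_Mapping.lookup \<rho> i = 0)"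
  have "\<exists>i. Poly_Mapping.lookup \<rho> i = 0"
    using ex_new_if_finite[OF infinite_UNIV_nat finite_keys[of \<rho>]]
    by (metis in_keys_iff)
  then have N: "Poly_Mapping.lookup \<rho> N = 0"
    unfolding N_def by (rule LeastI_ex)
  have "Poly_Mapping.lookup \<rho> i = 0 \<longleftrightarrow> N \<le> i" for i
  proof
    assume "N \<le> i"
    then have "Poly_Mapping.lookup \<rho> i \<le> 0"
      using decreasing_vec_antimono[OF assms] N by metis
    then show "Poly_Mapping.lookup \<rho> i = 0"
      using assms by (auto simp: decreasing_vec_def intro: antisym)
  next
    assume "Poly_Mapping.lookup \<rho> i = 0"
    then show "N \<le> i" unfolding N_def by (rule Least_le)
  qed
  then have "Poly_Mapping.keys \<rho> = {..<N}" by (intro set_eqI) (metis in_keys_iff lessThan_iff not_le)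
  then show thesis by (rule that)
qed

lemma decreasing_vec_lookup_0:
  assumes "decreasing_vec \<rho>" "\<rho> \<noteq> 0"
  shows "Poly_Mapping.lookup \<rho> 0 \<ge> 1"
proof -
  obtain N where N: "Poly_Mapping.keys \<rho> = {..<N}"
    using decreasing_vec_keys[OF assms(1)] .
  have "0 \<in> Poly_Mapping.keys \<rho>"
    using N assms(2) by (cases N) auto
  then have "Poly_Mapping.lookup \<rho> 0 \<noteq> 0" by (metis in_keys_iff)
  moreover have "Poly_Mapping.lookup \<rho> 0 \<ge> 0" using assms(1) by (simp add: decreasing_vec_def)
  ultimately show ?thesis by linarith
qed

text \<open>Lowering the entries up to \<open>k\<close> by one can only spoil the comparison of
  entries \<open>k\<close> and \<open>Suc k\<close>; as entry \<open>k\<close> is positive, the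
  lowered entries stay nonnegative.\<close>

lemma decreasing_vec_diff_ones_iff:
  assumes "decreasing_vec \<rho>" "Poly_Mapping.lookup \<rho> k \<noteq> 0"
  shows "decreasing_vec (\<rho> - ones (Suc k)) \<longleftrightarrow>
    Poly_Mapping.lookup \<rho> (Suc k) < Poly_Mapping.lookup \<rho> k"
proof -
  define r where "r = Poly_Mapping.lookup \<rho>"
  have nn: "0 \<le> r i" and le: "r (Suc i) \<le> r i" for i
    using assms(1) by (auto simp: decreasing_vec_def r_def)
  have "r k \<ge> 1" using assms(2) nn[of k] unfolding r_def by linarith
  then have ge1: "r i \<ge> 1" if "i \<le> k" for i
    using decreasing_vec_antimono[OF assms(1) that] unfolding r_def by linarith
  have lk: "Poly_Mapping.lookup (\<rho> - ones (Suc k)) i = r i - (if i \<le> k then 1 else 0)" for i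
    by (simp add: lookup_minus lookup_ones r_def less_Suc_eq_le)
  have "decreasing_vec (\<rho> - ones (Suc k)) \<longleftrightarrow> r (Suc k) < r k"
  proof
    assume "decreasing_vec (\<rho> - ones (Suc k))"
    then have "Poly_Mapping.lookup (\<rho> - ones (Suc k)) (Suc k)
        \<le> Poly_Mapping.lookup (\<rho> - ones (Suc k)) k"
      unfolding decreasing_vec_def by blast
    then show "r (Suc k) < r k" unfolding lk by simp
  next
    assume lt: "r (Suc k) < r k"
    show "decreasing_vec (\<rho> - ones (Suc k))"
      unfolding decreasing_vec_def lk
    proof (intro allI conjI)
      fix i
      show "0 \<le> r i - (if i \<le> k then 1 else 0)" using nn[of i] ge1[of i] by auto
      consider "i < k" | "i = k" | "i > k" by linarith
      then show "r (Suc i) - (if Suc i \<le> k then 1 else 0) \<le> r i - (if i \<le> k then 1 else 0)"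
        using le[of i] lt by cases auto
    qed
  qed
  then show ?thesis by (simp add: r_def)
qed

text \<open>Used in contrapositive form: a monomial outside the range of the sum defining a harmonic
  logarithm receives nothing from differentiating it.\<close>

lemma decreasing_vec_add_ones:
  assumes "decreasing_vec (\<rho> - ones k)"
  shows "decreasing_vec \<rho>"
proof -
  have 1: "0 \<le> Poly_Mapping.lookup \<rho> i - (if i < k then 1 else 0)"
     "Poly_Mapping.lookup \<rho> (Suc i) - (if Suc i < k then 1 else 0)
       \<le> Poly_Mapping.lookup \<rho> i - (if i < k then 1 else 0)" for i
    using assms unfolding decreasing_vec_def lookup_minus lookup_ones by auto
  have "0 \<le> Poly_Mapping.lookup \<rho> i \<and> Poly_Mapping.lookup \<rho> (Suc i) \<le> Poly_Mapping.lookup \<rho> i" for i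
    using 1[of i] by (cases "i < k"; cases "Suc i < k") auto
  then show ?thesis by (simp add: decreasing_vec_def)
qed

text \<open>Telescope \<open>\<Prod> A\<^sub>i - \<Prod> B\<^sub>i\<close>, where \<open>B\<^sub>i\<close> is the factor \<open>A\<^sub>i\<close> without its last argument;
  \<open>\<Prod> B\<^sub>i = 0\<close>, because the last nontrivial factor asks for more variables than it has.\<close>

lemma esym_prod_rec:
  assumes dec: "decreasing_vec \<rho>" and nz: "\<rho> \<noteq> 0"
  shows "esym_prod \<alpha> \<rho> = (\<Sum>k\<in>Poly_Mapping.keys \<rho>.
    (Poly_Mapping.lookup \<alpha> k - Poly_Mapping.lookup \<rho> k + 1) *
    (if decreasing_vec (\<rho> - ones (Suc k)) then esym_prod \<alpha> (\<rho> - ones (Suc k)) else 0))"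
proof -
  obtain N where N: "Poly_Mapping.keys \<rho> = {..<N}"
    using decreasing_vec_keys[OF dec] .
  define a r where "a = Poly_Mapping.lookup \<alpha>" and "r = Poly_Mapping.lookup \<rho>"
  have r0: "r i = 0" if "i \<ge> N" for i
  proof -
    have "i \<notin> Poly_Mapping.keys \<rho>" using N that by simp
    then show ?thesis by (metis in_keys_iff r_def)
  qed
  have rpos: "r i \<ge> 1" if "i < N" for i
  proof -
    have "i \<in> Poly_Mapping.keys \<rho>" using N that by simp
    then have "r i \<noteq> 0" by (metis in_keys_iff r_def)
    moreover have "r i \<ge> 0" using dec by (simp add: decreasing_vec_def r_def)
    ultimately show ?thesis by linarith
  qed
  have rdec: "r (Suc i) \<le> r i" for i
    using dec by (simp add: decreasing_vec_def r_def)
  have rnn: "r i \<ge> 0" for i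
    using dec by (simp add: decreasing_vec_def r_def)
  have "N > 0" using N nz by (cases N) auto
  define A where "A i = elem_sym (nat (r i - r (Suc i))) (nat (r i)) (\<lambda>j. a i - int j)" for i
  define B where "B i = elem_sym (nat (r i - r (Suc i))) (nat (r i - 1)) (\<lambda>j. a i - int j)" for i
  have "B (N - 1) = 0"
    unfolding B_def using \<open>N > 0\<close> r0[of N] rpos[of "N - 1"] by (intro elem_sym_eq_0) auto
  then have B0: "(\<Prod>i<N. B i) = 0"
    using \<open>N > 0\<close> by (auto intro!: prod_zero bexI[of _ "N - 1"])
  have "esym_prod \<alpha> \<rho> = (\<Prod>i<N. A i)"
    unfolding A_def a_def r_def by (rule esym_prod_eq) (use r0 in \<open>simp add: r_def\<close>)
  also have "\<dots> = (\<Sum>k<N. (\<Prod>i<k. B i) * (A k - B k) * (\<Prod>i\<in>{Suc k..<N}. A i))"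
    using prod_diff_telescope[of A N B] B0 by simp
  also have "\<dots> = (\<Sum>k<N. (a k - r k + 1) *
      (if decreasing_vec (\<rho> - ones (Suc k)) then esym_prod \<alpha> (\<rho> - ones (Suc k)) else 0))"
  proof (rule sum.cong[OF refl])
    fix k assume "k \<in> {..<N}"
    then have k: "k < N" by simp
    obtain m where m: "r k = int (Suc m)"
      by (rule that[of "nat (r k - 1)"]) (use rpos[OF k] in auto)
    have dec_iff: "decreasing_vec (\<rho> - ones (Suc k)) \<longleftrightarrow> r (Suc k) < r k"
      unfolding r_def by (rule decreasing_vec_diff_ones_iff[OF dec])
        (use rpos[OF k] in \<open>auto simp: r_def\<close>)
    show "(\<Prod>i<k. B i) * (A k - B k) * (\<Prod>i\<in>{Suc k..<N}. A i) = (a k - r k + 1) *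
      (if decreasing_vec (\<rho> - ones (Suc k)) then esym_prod \<alpha> (\<rho> - ones (Suc k)) else 0)"
    proof (cases "r (Suc k) < r k")
      case False
      \<comment> \<open>Equal neighbours make both factors \<open>e_0 = 1\<close>, and the shortened
        vector is not decreasing, so both sides vanish.\<close>
      then have "r (Suc k) = r k" using rdec[of k] by simp
      then have "A k = B k" by (simp add: A_def B_def)
      with False dec_iff show ?thesis by simp
    next
      case True
      obtain d where d: "r k - r (Suc k) = int (Suc d)"
        by (rule that[of "nat (r k - r (Suc k) - 1)"]) (use True in auto)
      define C where "C = elem_sym d m (\<lambda>j. a k - int j)"
      \<comment> \<open>Splitting off the last argument, \<open>a k - (r k - 1)\<close>, leaves
        \<open>C\<close>, which is the factor at \<open>k\<close> of the shortened vector.\<close>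
      have AB: "A k - B k = (a k - r k + 1) * C"
      proof -
        have e: "nat (r k - r (Suc k)) = Suc d" "nat (r k) = Suc m" "nat (r k - 1) = m" "r k = 1 + int m"
          using d m by auto
        show ?thesis unfolding A_def B_def C_def e(1-3) elem_sym_Suc_Suc
          by (simp add: e(4))
      qed
      let ?F = "\<lambda>i. elem_sym
         (nat (Poly_Mapping.lookup (\<rho> - ones (Suc k)) i - Poly_Mapping.lookup (\<rho> - ones (Suc k)) (Suc i)))
         (nat (Poly_Mapping.lookup (\<rho> - ones (Suc k)) i)) (\<lambda>j. Poly_Mapping.lookup \<alpha> i - int j)"
      have "esym_prod \<alpha> (\<rho> - ones (Suc k)) = (\<Prod>i<N. ?F i)"
        by (rule esym_prod_eq) (use r0 k in \<open>simp add: lookup_minus lookup_ones r_def\<close>)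
      also have "{..<N} = insert k ({..<k} \<union> {Suc k..<N})" using k by auto
      also have "(\<Prod>i\<in>insert k ({..<k} \<union> {Suc k..<N}). ?F i) =
          ?F k * ((\<Prod>i<k. ?F i) * (\<Prod>i\<in>{Suc k..<N}. ?F i))"
        by (subst prod.insert; (subst prod.union_disjoint)?) auto
      \<comment> \<open>Left of \<open>k\<close> both neighbours drop by one: the order of the
        symmetric function stays and only its last argument is lost. Right of \<open>k\<close>
        nothing changes.\<close>
      also have "(\<Prod>i<k. ?F i) = (\<Prod>i<k. B i)"
        by (rule prod.cong) (auto simp: B_def lookup_minus lookup_ones a_def r_def)
      also have "(\<Prod>i\<in>{Suc k..<N}. ?F i) = (\<Prod>i\<in>{Suc k..<N}. A i)"
        by (rule prod.cong) (auto simp: A_def lookup_minus lookup_ones a_def r_def)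
      also have "?F k = C"
      proof -
        have "r k - 1 - r (Suc k) = int d" "r k - 1 = int m" using d m by auto
        then show ?thesis
          by (simp add: C_def lookup_minus lookup_ones a_def r_def)
      qed
      finally have "esym_prod \<alpha> (\<rho> - ones (Suc k)) =
        C * ((\<Prod>i<k. B i) * (\<Prod>i\<in>{Suc k..<N}. A i))" .
      with True dec_iff AB show ?thesis by simp
    qed
  qed
  finally show ?thesis by (simp add: N a_def r_def)
qed

subsection \<open>The derivative of harmonic logarithms\<close>

definition roman_num :: "int \<Rightarrow> complex" where
  "roman_num n = (if n = 0 then 1 else of_int n)"

lemma roman_num_neq_0 [simp]: "roman_num n \<noteq> 0"
  by (simp add: roman_num_def)

lemma roman_fact_neq_0 [simp]: "roman_fact n \<noteq> 0"
  by (simp add: roman_fact_def)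

lemma roman_fact_of_nat [simp]: "roman_fact (int n) = fact n"
  by (simp add: roman_fact_def)

lemma roman_fact_rec: "roman_fact n = roman_num n * roman_fact (n - 1)"
proof -
  consider (pos) m where "n = int (Suc m)" | (zero) "n = 0" | (neg) m where "n = - int (Suc m)"
    by (metis int_cases3 gr0_implies_Suc)
  then show ?thesis
  proof cases
    case pos
    then have "n - 1 = int m" by simp
    with pos show ?thesis by (simp only: roman_fact_of_nat) (simp add: roman_num_def)
  next
    case zero
    then show ?thesis by (simp add: roman_num_def roman_fact_def)
  next
    case neg
    have "nat (- n - 1) = m" "nat (- (n - 1) - 1) = Suc m" "n < 0" "n - 1 < 0"
      using neg by auto
    moreover have "(-1 :: complex) powi (n - 1 - 1) = - ((-1) powi (n - 1))"
      by (subst power_int_diff) auto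
    moreover have "(of_int n :: complex) = - of_nat (Suc m)" using neg by simp
    ultimately show ?thesis
      by (simp add: roman_num_def roman_fact_def field_simps del: of_nat_Suc)
  qed
qed

section \<open>Stirling numbers with integer first index\<close>

abbreviation gamma_quot :: "int \<Rightarrow> complex \<Rightarrow> complex" where
  "gamma_quot m \<equiv> (\<lambda>y. Gamma (y + 1) / Gamma (y - of_int m + 1))"

text \<open>The numerator is analytic since \<open>Gamma\<close> has no pole at \<open>1\<close>.
  Dividing by \<open>Gamma\<close> is multiplying by the entire function \<open>rGamma\<close>, even
  at the poles, where both sides are \<open>0\<close> by convention.\<close>

lemma gamma_quot_has_fps_expansion:
  "gamma_quot m has_fps_expansion Abs_fps (roman_stirling m)"
proof -
  have "(\<lambda>y. Gamma (y + 1)) analytic_on {0::complex}"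
    by (rule analytic_on_compose_gen[of "\<lambda>y. y + 1" _ Gamma "{1}", unfolded o_def])
       (auto intro!: analytic_intros analytic_Gamma simp: nonpos_Ints_def)
  moreover have "(\<lambda>y. rGamma (y - of_int m + 1)) analytic_on {0::complex}"
    by (rule analytic_on_compose_gen[of "\<lambda>y. y - of_int m + 1" _ rGamma UNIV, unfolded o_def])
       (auto intro!: analytic_intros analytic_rGamma)
  ultimately have "(\<lambda>y. Gamma (y + 1) * rGamma (y - of_int m + 1)) analytic_on {0::complex}"
    by (rule analytic_on_mult)
  then have "gamma_quot m analytic_on {0}"
    by (simp add: rGamma_inverse_Gamma divide_inverse)
  then have "gamma_quot m has_fps_expansion fps_expansion (gamma_quot m) 0"
    by (rule analytic_at_imp_has_fps_expansion_0)
  also have "fps_expansion (gamma_quot m) 0 = Abs_fps (roman_stirling m)"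
    by (simp add: fps_eq_iff roman_stirling_def)
  finally show ?thesis .
qed

text \<open>The functional equation of the reciprocal Gamma function, valid at every point.\<close>

lemma gamma_quot_rec: "gamma_quot (m + 1) y = (y - of_int m) * gamma_quot m y"
  using rGamma_plus1[of "y - of_int m"]
  by (simp add: rGamma_inverse_Gamma divide_inverse algebra_simps)

lemma roman_stirling_fps_rec:
  "Abs_fps (roman_stirling (m + 1)) = (fps_X - fps_const (of_int m)) * Abs_fps (roman_stirling m)"
proof -
  have "(\<lambda>y. (y - of_int m) * gamma_quot m y) has_fps_expansion
      (fps_X - fps_const (of_int m)) * Abs_fps (roman_stirling m)"
    by (intro fps_expansion_intros gamma_quot_has_fps_expansion)
  then have "gamma_quot (m + 1) has_fps_expansion
      (fps_X - fps_const (of_int m)) * Abs_fps (roman_stirling m)"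
    by (simp only: gamma_quot_rec)
  with gamma_quot_has_fps_expansion[of "m + 1"] show ?thesis
    using fps_expansion_unique_complex by blast
qed

lemma roman_stirling_Suc:
  "roman_stirling (m + 1) (Suc r) = roman_stirling m r - of_int m * roman_stirling m (Suc r)"
proof -
  have "roman_stirling (m + 1) (Suc r) = fps_nth (Abs_fps (roman_stirling (m + 1))) (Suc r)" by simp
  also have "\<dots> = roman_stirling m r - of_int m * roman_stirling m (Suc r)"
    unfolding roman_stirling_fps_rec by (simp add: left_diff_distrib)
  finally show ?thesis .
qed

lemma roman_stirling_Suc_0: "roman_stirling (m + 1) 0 = - of_int m * roman_stirling m 0"
proof -
  have "roman_stirling (m + 1) 0 = fps_nth (Abs_fps (roman_stirling (m + 1))) 0" by simp
  also have "\<dots> = - of_int m * roman_stirling m 0"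
    unfolding roman_stirling_fps_rec by (simp add: left_diff_distrib)
  finally show ?thesis .
qed

lemma roman_stirling_0_0 [simp]: "roman_stirling 0 0 = 1"
  by (simp add: roman_stirling_def fps_expansion_def)

text \<open>This normalises the coefficient at \<open>\<rho> = 0\<close> of a harmonic logarithm of
  nonnegative degree to \<open>1\<close>.\<close>

lemma roman_stirling_neg_0: "roman_stirling (- int n) 0 = 1 / fact n"
proof (induction n)
  case (Suc n)
  have "roman_stirling (- int n) 0 = of_nat (Suc n) * roman_stirling (- int (Suc n)) 0"
    using roman_stirling_Suc_0[of "- int (Suc n)"] by (simp add: algebra_simps)
  with Suc.IH show ?case by (simp add: field_simps del: of_nat_Suc)
qed simp

text \<open>The step from \<open>0\<close> to \<open>1\<close> multiplies the constant term by zero.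
  Hence the term with \<open>\<rho> = 0\<close> is absent in negative degree.\<close>

lemma roman_stirling_pos_0:
  assumes "m > 0"
  shows "roman_stirling m 0 = 0"
  using assms
proof (induction m rule: int_gr_induct)
  case base
  show ?case using roman_stirling_Suc_0[of 0] by simp
next
  case (step m)
  then show ?case using roman_stirling_Suc_0[of m] by simp
qed

text \<open>With the constant term gone, each step from a positive \<open>m\<close> multiplies the
  linear term by \<open>- m\<close>. In negative degree the terms whose \<open>\<rho>\<close> has
  first entry \<open>1\<close> thus become the leading candidates.\<close>

lemma roman_stirling_pos_1:
  assumes "m > 0"
  shows "roman_stirling m 1 \<noteq> 0"
  using assms
proof (induction m rule: int_gr_induct)
  case base
  show ?case using roman_stirling_Suc[of 0 0] by simp
next
  case (step m)
  then show ?case using roman_stirling_Suc[of m 0] roman_stirling_pos_0[of m] by simp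
qed

section \<open>Coefficients of harmonic logarithms\<close>

lemma harmonic_coeff_eq:
  "harmonic_coeff n \<alpha> \<rho> =
    roman_fact n * roman_stirling (- n) (nat (Poly_Mapping.lookup \<rho> 0)) * of_int (esym_prod \<alpha> \<rho>)"
  by (simp add: harmonic_coeff_def esym_prod_def Let_def)

text \<open>A monomial with exponents \<open>\<beta>\<close> can only come from
  \<open>\<rho> = \<alpha> - \<beta>\<close>, so each coefficient of the formal sum has at most one
  nonzero contribution.\<close>

lemma harmonic_log_eq:
  "harmonic_log n \<alpha> m \<beta> =
    (if m = n \<and> decreasing_vec (\<alpha> - \<beta>) then harmonic_coeff n \<alpha> (\<alpha> - \<beta>) else 0)"
  unfolding harmonic_log_def formal_sum_def
  by (subst Sum_any_singleton[of "\<alpha> - \<beta>"]) (auto simp: ell_def)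

text \<open>This is \<open>D \<lambda>\<^sub>n = \<lfloor>n\<rceil> \<lambda>\<^sub>n\<^sub>-\<^sub>1\<close>, read off at a single monomial.\<close>

lemma harmonic_coeff_deriv:
  assumes dec: "decreasing_vec \<rho>"
  shows "of_int n * harmonic_coeff n \<alpha> \<rho> + (\<Sum>k\<in>Poly_Mapping.keys \<rho>.
      of_int (Poly_Mapping.lookup \<alpha> k - Poly_Mapping.lookup \<rho> k + 1) *
      (if decreasing_vec (\<rho> - ones (Suc k)) then harmonic_coeff n \<alpha> (\<rho> - ones (Suc k)) else 0))
    = roman_num n * harmonic_coeff (n - 1) \<alpha> \<rho>"
proof (cases "\<rho> = 0")
  case True
  then show ?thesis
    using roman_stirling_Suc_0[of "-n"] roman_fact_rec[of n] by (simp add: harmonic_coeff_eq)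
next
  case False
  have "Poly_Mapping.lookup \<rho> 0 \<ge> 1" using decreasing_vec_lookup_0[OF dec False] .
  then obtain r where r: "Poly_Mapping.lookup \<rho> 0 = int (Suc r)"
    by (intro that[of "nat (Poly_Mapping.lookup \<rho> 0 - 1)"]) auto
  \<comment> \<open>Every \<open>ones (Suc k)\<close> lowers the first entry by exactly one, so the
    Stirling factor is the same in all terms and \<open>esym_prod_rec\<close> sums the rest.\<close>
  have "(\<Sum>k\<in>Poly_Mapping.keys \<rho>.
      of_int (Poly_Mapping.lookup \<alpha> k - Poly_Mapping.lookup \<rho> k + 1) *
      (if decreasing_vec (\<rho> - ones (Suc k)) then harmonic_coeff n \<alpha> (\<rho> - ones (Suc k)) else 0))
    = roman_fact n * roman_stirling (- n) r * of_int (esym_prod \<alpha> \<rho>)"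
    unfolding esym_prod_rec[OF dec False, of \<alpha>] of_int_sum sum_distrib_left
    by (intro sum.cong refl)
       (simp add: harmonic_coeff_eq lookup_minus lookup_ones r)
  moreover have "roman_stirling (1 - n) (Suc r) =
      roman_stirling (- n) r + of_int n * roman_stirling (- n) (Suc r)"
    using roman_stirling_Suc[of "-n" r] by simp
  ultimately show ?thesis
    using roman_fact_rec[of n] r
    by (simp add: harmonic_coeff_eq algebra_simps del: of_nat_Suc)
qed

section \<open>The derivative on formal series\<close>

lemma D_ell_eq_0: "m \<noteq> n - 1 \<Longrightarrow> D_ell n \<alpha> m \<beta> = 0"
  by (simp add: D_ell_def ell_def)

text \<open>Only \<open>\<beta>\<close> and the vectors \<open>\<beta> + ones (Suc k)\<close> in
  degree \<open>m + 1\<close> differentiate into the given monomial. The finite set \<open>K\<close>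
  keeps this a finite sum; \<open>Sum_any\<close> would otherwise default to
  \<open>0\<close>.\<close>

lemma D_ser_eq:
  assumes "finite K" "\<And>k. f (m + 1) (\<beta> + ones (Suc k)) \<noteq> 0 \<Longrightarrow> k \<in> K"
  shows "D_ser f m \<beta> = of_int (m + 1) * f (m + 1) \<beta> +
    (\<Sum>k\<in>K. of_int (Poly_Mapping.lookup \<beta> k + 1) * f (m + 1) (\<beta> + ones (Suc k)))"
proof -
  let ?S = "(\<lambda>k. \<beta> + ones (Suc k)) ` K"
  let ?A = "Pair (m + 1) ` insert \<beta> ?S"
  have zero: "f n \<alpha> * D_ell n \<alpha> m \<beta> = 0" if "(n, \<alpha>) \<notin> ?A" for n \<alpha>
  proof (cases "n = m + 1 \<and> f n \<alpha> \<noteq> 0")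
    case False
    then show ?thesis by (cases "n = m + 1") (auto simp: D_ell_eq_0)
  next
    case True
    with that have "\<alpha> \<noteq> \<beta>" "\<alpha> \<notin> ?S" by auto
    moreover have "\<beta> \<noteq> \<alpha> - ones (Suc k)" for k
    proof
      assume "\<beta> = \<alpha> - ones (Suc k)"
      then have "\<alpha> = \<beta> + ones (Suc k)" by (simp add: algebra_simps)
      with assms(2)[of k] True \<open>\<alpha> \<notin> ?S\<close> show False by auto
    qed
    ultimately show ?thesis by (simp add: D_ell_def ell_def)
  qed
  have D1: "D_ell (m + 1) \<beta> m \<beta> = of_int (m + 1)"
    by (auto simp: D_ell_def ell_def intro!: sum.neutral)
  have D2: "D_ell (m + 1) (\<beta> + ones (Suc k)) m \<beta> = of_int (Poly_Mapping.lookup \<beta> k + 1)" for k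
  proof -
    let ?\<alpha> = "\<beta> + ones (Suc k)"
    have e: "\<beta> = ?\<alpha> - ones (Suc k') \<longleftrightarrow> k' = k" for k'
      by (auto simp: eq_diff_eq)
    have "D_ell (m + 1) ?\<alpha> m \<beta> =
        0 + (\<Sum>k'\<in>Poly_Mapping.keys ?\<alpha>. if k' = k then of_int (Poly_Mapping.lookup ?\<alpha> k') else 0)"
      unfolding D_ell_def ell_def
      by (rule arg_cong2[of _ _ _ _ "(+)"]; (rule sum.cong[OF refl])?) (auto simp: e)
    also have "\<dots> = (if k \<in> Poly_Mapping.keys ?\<alpha> then of_int (Poly_Mapping.lookup ?\<alpha> k) else 0)"
      by (subst sum.delta) simp_all
    also have "\<dots> = of_int (Poly_Mapping.lookup ?\<alpha> k)"
      by (metis in_keys_iff of_int_0)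
    finally show ?thesis by (simp add: lookup_add lookup_ones)
  qed
  have "D_ser f m \<beta> = (\<Sum>x\<in>?A. f (fst x) (snd x) * D_ell (fst x) (snd x) m \<beta>)"
    unfolding D_ser_def formal_sum_def case_prod_unfold
  proof (rule Sum_any.expand_superset)
    show "{x. f (fst x) (snd x) * D_ell (fst x) (snd x) m \<beta> \<noteq> 0} \<subseteq> ?A"
      using zero by (metis (mono_tags, lifting) mem_Collect_eq prod.collapse subsetI)
  qed (use assms(1) in simp)
  also have "\<dots> = (\<Sum>\<alpha>\<in>insert \<beta> ?S. f (m + 1) \<alpha> * D_ell (m + 1) \<alpha> m \<beta>)"
    by (subst sum.reindex) (auto simp: inj_on_def)
  also have "\<dots> = f (m + 1) \<beta> * D_ell (m + 1) \<beta> m \<beta> +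
      (\<Sum>k\<in>K. f (m + 1) (\<beta> + ones (Suc k)) * D_ell (m + 1) (\<beta> + ones (Suc k)) m \<beta>)"
    by (subst sum.insert) (use assms(1) in \<open>auto simp: sum.reindex inj_on_def\<close>)
  finally show ?thesis by (simp add: D1 D2 mult.commute)
qed

text \<open>A series of order \<open>\<alpha>\<close> with coefficients \<open>c\<close>. Harmonic
  logarithms of different degrees share no monomial, so the formal sum collapses to a pointwise
  product.\<close>

definition log_comb :: "(int \<Rightarrow> complex) \<Rightarrow> logvec \<Rightarrow> logser" where
  "log_comb c \<alpha> = (\<lambda>n \<beta>. c n * harmonic_log n \<alpha> n \<beta>)"

lemma formal_sum_harmonic_log: "formal_sum c (\<lambda>k. harmonic_log k \<alpha>) = log_comb c \<alpha>"
proof (intro ext)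
  fix m \<beta>
  show "formal_sum c (\<lambda>k. harmonic_log k \<alpha>) m \<beta> = log_comb c \<alpha> m \<beta>"
    unfolding formal_sum_def log_comb_def
    by (subst Sum_any_singleton[of m]) (auto simp: harmonic_log_eq)
qed

lemma D_ser_log_comb:
  "D_ser (log_comb c \<alpha>) = log_comb (\<lambda>n. roman_num (n + 1) * c (n + 1)) \<alpha>"
proof (intro ext)
  fix m \<beta>
  define \<rho> where "\<rho> = \<alpha> - \<beta>"
  define K where "K = Poly_Mapping.keys \<rho>"
  have \<beta>: "\<beta> = \<alpha> - \<rho>" by (simp add: \<rho>_def)
  have \<rho>': "\<alpha> - (\<beta> + ones (Suc k)) = \<rho> - ones (Suc k)" for k
    by (simp add: \<beta> algebra_simps)
  \<comment> \<open>Lowering entry \<open>k\<close> must leave it nonnegative, which confines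
    \<open>k\<close> to the finite support of \<open>\<rho>\<close>.\<close>
  have "k \<in> K" if "log_comb c \<alpha> (m + 1) (\<beta> + ones (Suc k)) \<noteq> 0" for k
  proof -
    have "decreasing_vec (\<rho> - ones (Suc k))"
      using that by (auto simp: log_comb_def harmonic_log_eq \<rho>' split: if_splits)
    then have "Poly_Mapping.lookup (\<rho> - ones (Suc k)) k \<ge> 0"
      by (simp add: decreasing_vec_def)
    then have "Poly_Mapping.lookup \<rho> k \<noteq> 0" by (simp add: lookup_minus lookup_ones)
    then show ?thesis unfolding K_def by (metis in_keys_iff)
  qed
  then have *: "D_ser (log_comb c \<alpha>) m \<beta> = of_int (m + 1) * log_comb c \<alpha> (m + 1) \<beta> +
    (\<Sum>k\<in>K. of_int (Poly_Mapping.lookup \<beta> k + 1) * log_comb c \<alpha> (m + 1) (\<beta> + ones (Suc k)))"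
    by (intro D_ser_eq) (auto simp: K_def)
  show "D_ser (log_comb c \<alpha>) m \<beta> = log_comb (\<lambda>n. roman_num (n + 1) * c (n + 1)) \<alpha> m \<beta>"
  proof (cases "decreasing_vec \<rho>")
    case False
    then have "\<not> decreasing_vec (\<rho> - ones (Suc k))" for k
      using decreasing_vec_add_ones by blast
    with False show ?thesis
      unfolding * by (simp add: log_comb_def harmonic_log_eq \<rho>' \<rho>_def[symmetric])
  next
    case True
    have "D_ser (log_comb c \<alpha>) m \<beta> = c (m + 1) *
       (of_int (m + 1) * harmonic_coeff (m + 1) \<alpha> \<rho> + (\<Sum>k\<in>Poly_Mapping.keys \<rho>.
      of_int (Poly_Mapping.lookup \<alpha> k - Poly_Mapping.lookup \<rho> k + 1) *
      (if decreasing_vec (\<rho> - ones (Suc k)) then harmonic_coeff (m + 1) \<alpha> (\<rho> - ones (Suc k)) else 0)))"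
      unfolding * distrib_left sum_distrib_left K_def
      by (intro arg_cong2[of _ _ _ _ "(+)"] sum.cong refl)
         (use True in \<open>auto simp: log_comb_def harmonic_log_eq \<rho>' \<rho>_def[symmetric] \<beta> lookup_minus\<close>)
    also have "\<dots> = c (m + 1) * (roman_num (m + 1) * harmonic_coeff m \<alpha> \<rho>)"
      using harmonic_coeff_deriv[OF True, of "m + 1" \<alpha>] by simp
    finally show ?thesis
      using True by (simp add: log_comb_def harmonic_log_eq \<rho>_def[symmetric])
  qed
qed

text \<open>The brackets \<open>\<lfloor>n + 1\<rceil>\<close>, ...,
  \<open>\<lfloor>n + i\<rceil>\<close> telescope to a quotient of Roman factorials.\<close>

lemma funpow_D_ser_log_comb:
  "(D_ser ^^ i) (log_comb c \<alpha>) =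
    log_comb (\<lambda>n. roman_fact (n + int i) / roman_fact n * c (n + int i)) \<alpha>"
proof (induction i)
  case (Suc i)
  have "roman_num (n + 1) * (roman_fact (n + 1 + int i) / roman_fact (n + 1)) =
      roman_fact (n + int (Suc i)) / roman_fact n" for n
    using roman_fact_rec[of "n + 1"] by (simp add: add_ac field_simps)
  then have "(\<lambda>n. roman_num (n + 1) * (roman_fact (n + 1 + int i) / roman_fact (n + 1) * c (n + 1 + int i)))
     = (\<lambda>n. roman_fact (n + int (Suc i)) / roman_fact n * c (n + int (Suc i)))"
    by (intro ext) (metis add.assoc add.commute mult.assoc of_nat_Suc)
  then show ?case by (simp only: funpow.simps o_apply Suc.IH D_ser_log_comb)
qed simp

subsection \<open>Linear independence and skip operators\<close>

text \<open>The order is lexicographic with the smallest index deciding; leading monomials are meant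
  with respect to it.\<close>

lemma less_poly_mapping_iff:
  "f < g \<longleftrightarrow> (\<exists>k. Poly_Mapping.lookup f k < Poly_Mapping.lookup g k \<and>
     (\<forall>k'<k. Poly_Mapping.lookup f k' = Poly_Mapping.lookup g k'))"
  by (simp add: less_poly_mapping.rep_eq less_fun_def)

lemma decreasing_vec_ones: "decreasing_vec (ones k)"
  by (simp add: decreasing_vec_def lookup_ones)

lemma decreasing_vec_eq_ones:
  assumes "decreasing_vec \<rho>" "Poly_Mapping.lookup \<rho> 0 = 1"
  obtains i where "\<rho> = ones (Suc i)"
proof -
  obtain N where N: "Poly_Mapping.keys \<rho> = {..<N}"
    using decreasing_vec_keys[OF assms(1)] .
  have "Poly_Mapping.lookup \<rho> i = (if i < N then 1 else 0)" for i
  proof -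
    have "i < N \<longleftrightarrow> Poly_Mapping.lookup \<rho> i \<noteq> 0" using N by (metis in_keys_iff lessThan_iff)
    moreover have "Poly_Mapping.lookup \<rho> i \<le> 1"
      using decreasing_vec_antimono[OF assms(1), of 0 i] assms(2) by simp
    moreover have "Poly_Mapping.lookup \<rho> i \<ge> 0" using assms(1) by (simp add: decreasing_vec_def)
    ultimately show ?thesis by auto
  qed
  then have "\<rho> = ones N" by (intro poly_mapping_eqI) (simp add: lookup_ones)
  moreover have "N \<noteq> 0" using calculation assms(2) by (auto simp: lookup_ones split: if_splits)
  ultimately show thesis using that[of "N - 1"] by simp
qed

lemma esym_prod_ones: "esym_prod \<alpha> (ones (Suc i)) = Poly_Mapping.lookup \<alpha> i"
proof -
  have "elem_sym (Suc 0) (Suc 0) x = x 0" for x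
    using elem_sym_Suc_Suc[of 0 0 x] by (simp add: elem_sym_eq_0)
  then show ?thesis
    by (subst esym_prod_eq[of "Suc i"]) (auto simp: lookup_ones)
qed

lemma elem_sym_full: "elem_sym k k x = (\<Prod>j<k. x j)"
  by (induction k) (simp_all add: elem_sym_Suc_Suc elem_sym_eq_0 mult.commute)

text \<open>At the last nonzero entry of \<open>\<rho>\<close> the symmetric function is the product
  of all its arguments, the first of which is \<open>0\<close>. So order zero yields nothing but
  powers of \<open>x\<close>.\<close>

lemma esym_prod_zero_left:
  assumes "decreasing_vec \<rho>" "\<rho> \<noteq> 0"
  shows "esym_prod 0 \<rho> = 0"
proof -
  obtain N where N: "Poly_Mapping.keys \<rho> = {..<N}"
    using decreasing_vec_keys[OF assms(1)] .
  have N0: "N \<noteq> 0" using N assms(2) by (cases N) auto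
  have z: "Poly_Mapping.lookup \<rho> i = 0" if "i \<ge> N" for i
    using that N by (metis in_keys_iff lessThan_iff not_le)
  have "Poly_Mapping.lookup \<rho> (N - 1) \<noteq> 0"
    using N N0 by (metis diff_less in_keys_iff lessThan_iff less_one not_gr_zero)
  moreover have "Poly_Mapping.lookup \<rho> (N - 1) \<ge> 0"
    using assms(1) by (simp add: decreasing_vec_def)
  ultimately have "(\<Prod>j<nat (Poly_Mapping.lookup \<rho> (N - 1)). - int j) = 0"
    by (intro prod_zero) (auto intro!: bexI[of _ 0])
  then show ?thesis
    using N0 z[of N] by (subst esym_prod_eq[of N]) (auto intro!: prod_zero bexI[of _ "N - 1"] simp: z elem_sym_full)
qed

lemma harmonic_log_0:
  "harmonic_log n 0 m \<beta> = (if m = n \<and> n \<ge> 0 \<and> \<beta> = 0 then 1 else 0)"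
proof (cases "\<beta> = 0")
  case True
  have "harmonic_coeff n 0 0 = (if n \<ge> 0 then 1 else 0)"
  proof (cases "n \<ge> 0")
    case nonneg: True
    then obtain k where "n = int k" using nonneg_int_cases by blast
    then show ?thesis by (simp add: harmonic_coeff_eq roman_stirling_neg_0)
  next
    case False
    then show ?thesis by (simp add: harmonic_coeff_eq roman_stirling_pos_0)
  qed
  with True show ?thesis by (simp add: harmonic_log_eq decreasing_vec_def)
next
  case False
  then show ?thesis
    using esym_prod_zero_left[of "- \<beta>"] by (simp add: harmonic_log_eq harmonic_coeff_eq)
qed

text \<open>The lexicographically largest exponent vector occurring in \<open>\<lambda>\<^sub>n\<^sup>\<alpha>\<close>.  For negative \<open>n\<close> the
  vector \<open>\<alpha>\<close> itself is missing, as \<open>s(-n, 0) = 0\<close>.  (\<open>LEAST\<close> is junk for \<open>\<alpha> = 0\<close>.)\<close>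

definition lead_vec :: "int \<Rightarrow> logvec \<Rightarrow> logvec" where
  "lead_vec n \<alpha> = (if n \<ge> 0 then \<alpha> else \<alpha> - ones (Suc (LEAST j. Poly_Mapping.lookup \<alpha> j \<noteq> 0)))"

lemma lookup_Least_neq_0:
  fixes \<alpha> :: logvec
  assumes "\<alpha> \<noteq> 0"
  shows "Poly_Mapping.lookup \<alpha> (LEAST j. Poly_Mapping.lookup \<alpha> j \<noteq> 0) \<noteq> 0"
proof -
  have "\<exists>j. Poly_Mapping.lookup \<alpha> j \<noteq> 0"
    using assms poly_mapping_eqI[of \<alpha> 0] by auto
  then show ?thesis by (rule LeastI_ex)
qed

text \<open>In negative degree this coefficient is a Roman factorial times \<open>s(-n, 1)\<close>
  times the first nonzero entry of \<open>\<alpha>\<close>.\<close>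

lemma harmonic_log_lead_vec_neq_0:
  assumes "n \<ge> 0 \<or> \<alpha> \<noteq> 0"
  shows "harmonic_log n \<alpha> n (lead_vec n \<alpha>) \<noteq> 0"
proof (cases "n \<ge> 0")
  case True
  then obtain k where "n = int k" using nonneg_int_cases by blast
  then show ?thesis
    by (simp add: harmonic_log_eq harmonic_coeff_eq lead_vec_def roman_stirling_neg_0 decreasing_vec_def)
next
  case False
  then show ?thesis
    using assms lookup_Least_neq_0[of \<alpha>] roman_stirling_pos_1[of "- n"]
    by (simp add: harmonic_log_eq harmonic_coeff_eq lead_vec_def decreasing_vec_ones esym_prod_ones
        lookup_ones)
qed

text \<open>A larger first entry of \<open>\<rho>\<close> gives a smaller exponent vector. In
  negative degree the least possible first entry is \<open>1\<close>; then
  \<open>\<rho> = ones (Suc i)\<close> with entry \<open>i\<close> of \<open>\<alpha>\<close>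
  nonzero, and the shortest such block of ones gives the largest vector.\<close>

lemma harmonic_log_le_lead_vec:
  assumes nz: "harmonic_log n \<alpha> n \<beta> \<noteq> 0"
  shows "\<beta> \<le> lead_vec n \<alpha>"
proof -
  define \<rho> where "\<rho> = \<alpha> - \<beta>"
  have \<beta>: "\<beta> = \<alpha> - \<rho>" by (simp add: \<rho>_def)
  have dec: "decreasing_vec \<rho>" and s: "roman_stirling (- n) (nat (Poly_Mapping.lookup \<rho> 0)) \<noteq> 0"
    and E: "esym_prod \<alpha> \<rho> \<noteq> 0"
    using nz by (auto simp: harmonic_log_eq harmonic_coeff_eq \<rho>_def[symmetric] split: if_splits)
  show ?thesis
  proof (cases "n \<ge> 0")
    case True
    have "\<beta> < \<alpha>" if "\<rho> \<noteq> 0"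
      unfolding less_poly_mapping_iff \<beta>
      using decreasing_vec_lookup_0[OF dec that] by (intro exI[of _ 0]) (simp add: lookup_minus)
    then show ?thesis
      using True \<beta> by (cases "\<rho> = 0") (auto simp: lead_vec_def less_imp_le)
  next
    case False
    define j where "j = (LEAST j. Poly_Mapping.lookup \<alpha> j \<noteq> 0)"
    have lead: "lead_vec n \<alpha> = \<alpha> - ones (Suc j)" using False by (simp add: lead_vec_def j_def)
    have "\<rho> \<noteq> 0" using s False roman_stirling_pos_0[of "- n"] by auto
    then have ge1: "Poly_Mapping.lookup \<rho> 0 \<ge> 1" by (rule decreasing_vec_lookup_0[OF dec])
    show ?thesis
    proof (cases "Poly_Mapping.lookup \<rho> 0 = 1")
      case False
      then have "\<beta> < lead_vec n \<alpha>"
        unfolding less_poly_mapping_iff lead \<beta>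
        using ge1 by (intro exI[of _ 0]) (simp add: lookup_minus lookup_ones)
      then show ?thesis by simp
    next
      case True
      then obtain i where i: "\<rho> = ones (Suc i)"
        using decreasing_vec_eq_ones[OF dec] by blast
      then have "Poly_Mapping.lookup \<alpha> i \<noteq> 0" using E by (simp add: esym_prod_ones)
      then have "j \<le> i" unfolding j_def by (rule Least_le)
      moreover have "\<beta> < lead_vec n \<alpha>" if "j < i"
        unfolding less_poly_mapping_iff lead \<beta> i
        using that by (intro exI[of _ "Suc j"]) (simp add: lookup_minus lookup_ones)
      ultimately show ?thesis using i lead \<beta> by (cases "i = j") auto
    qed
  qed
qed

lemma lead_vec_inj:
  assumes "n \<ge> 0 \<or> \<alpha> \<noteq> 0" "n \<ge> 0 \<or> \<beta> \<noteq> 0" "lead_vec n \<alpha> = lead_vec n \<beta>"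
  shows "\<alpha> = \<beta>"
proof (cases "n \<ge> 0")
  case True
  then show ?thesis using assms(3) by (simp add: lead_vec_def)
next
  case False
  define L where "L \<alpha> = (LEAST j. Poly_Mapping.lookup \<alpha> j \<noteq> 0)" for \<alpha> :: logvec
  \<comment> \<open>Otherwise both blocks of ones cover the index \<open>L \<alpha>\<close>, so the
    vectors agree there, although one entry is nonzero and the other is zero.\<close>
  have *: "\<not> L \<alpha> < L \<beta>" if "\<alpha> \<noteq> 0" "\<alpha> - ones (Suc (L \<alpha>)) = \<beta> - ones (Suc (L \<beta>))" for \<alpha> \<beta>
  proof
    assume less: "L \<alpha> < L \<beta>"
    have "Poly_Mapping.lookup (\<alpha> - ones (Suc (L \<alpha>))) (L \<alpha>) =
        Poly_Mapping.lookup (\<beta> - ones (Suc (L \<beta>))) (L \<alpha>)" using that by simp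
    then have "Poly_Mapping.lookup \<alpha> (L \<alpha>) = Poly_Mapping.lookup \<beta> (L \<alpha>)"
      using less by (simp add: lookup_minus lookup_ones)
    moreover have "Poly_Mapping.lookup \<beta> (L \<alpha>) = 0"
      using less not_less_Least unfolding L_def by blast
    ultimately show False using lookup_Least_neq_0[OF that(1)] by (simp add: L_def)
  qed
  have eq: "\<alpha> - ones (Suc (L \<alpha>)) = \<beta> - ones (Suc (L \<beta>))" and "\<alpha> \<noteq> 0" "\<beta> \<noteq> 0"
    using False assms by (auto simp: lead_vec_def L_def)
  then have "L \<alpha> = L \<beta>" 
    using *[OF \<open>\<alpha> \<noteq> 0\<close> eq] *[OF \<open>\<beta> \<noteq> 0\<close> eq[symmetric]] by linarith
  then show ?thesis using eq by simp
qed

text \<open>Among the orders with nonzero coefficient, the largest leading vector belongs to just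
  one, and no other order has a term there to cancel it.\<close>

lemma harmonic_log_independent:
  assumes fin: "finite S" and S: "\<And>\<gamma>. \<gamma> \<in> S \<Longrightarrow> n \<ge> 0 \<or> \<gamma> \<noteq> 0"
    and sum: "\<And>\<beta>. (\<Sum>\<gamma>\<in>S. d \<gamma> * harmonic_log n \<gamma> n \<beta>) = 0"
    and \<gamma>: "\<gamma> \<in> S"
  shows "d \<gamma> = 0"
proof (rule ccontr)
  assume "d \<gamma> \<noteq> 0"
  define T where "T = {\<gamma>\<in>S. d \<gamma> \<noteq> 0}"
  have T: "finite T" "T \<noteq> {}" using fin \<gamma> \<open>d \<gamma> \<noteq> 0\<close> by (auto simp: T_def)
  define M where "M = Max (lead_vec n ` T)"
  have "M \<in> lead_vec n ` T" unfolding M_def using T by (intro Max_in) auto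
  then obtain \<gamma>0 where \<gamma>0: "\<gamma>0 \<in> T" "M = lead_vec n \<gamma>0" by auto
  have "d \<gamma>' * harmonic_log n \<gamma>' n M = 0" if "\<gamma>' \<in> S - {\<gamma>0}" for \<gamma>'
  proof (rule ccontr)
    assume nz: "d \<gamma>' * harmonic_log n \<gamma>' n M \<noteq> 0"
    then have "\<gamma>' \<in> T" "M \<le> lead_vec n \<gamma>'"
      using that by (auto simp: T_def intro!: harmonic_log_le_lead_vec)
    moreover from this have "lead_vec n \<gamma>' \<le> M" unfolding M_def using T by (intro Max_ge) auto
    ultimately have eq: "lead_vec n \<gamma>' = lead_vec n \<gamma>0" using \<gamma>0 by simp
    have "\<gamma>' = \<gamma>0"
      by (rule lead_vec_inj[OF _ _ eq])
         (use that \<gamma>0 S[of \<gamma>'] S[of \<gamma>0] in \<open>auto simp: T_def\<close>)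
    with that show False by simp
  qed
  then have "(\<Sum>\<gamma>\<in>S. d \<gamma> * harmonic_log n \<gamma> n M) = d \<gamma>0 * harmonic_log n \<gamma>0 n M"
    using fin \<gamma>0 by (subst sum.remove[of _ \<gamma>0]) (auto simp: T_def sum.neutral)
  then show False
    using sum[of M] \<gamma>0 harmonic_log_lead_vec_neq_0[of n \<gamma>0] S[of \<gamma>0] by (simp add: T_def)
qed

section \<open>Skip operators on series of a single order\<close>

lemma formal_sum_pairs:
  assumes "finite S" "\<And>\<gamma> n. \<gamma> \<notin> S \<Longrightarrow> c \<gamma> n = 0" "\<And>n \<gamma>. n \<noteq> m \<Longrightarrow> F n \<gamma> m \<beta> = 0"
  shows "formal_sum (\<lambda>(n, \<gamma>). c \<gamma> n) (\<lambda>(n, \<gamma>). F n \<gamma>) m \<beta> = (\<Sum>\<gamma>\<in>S. c \<gamma> m * F m \<gamma> m \<beta>)"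
proof -
  have zero: "c \<gamma> n * F n \<gamma> m \<beta> = 0" if "(n, \<gamma>) \<notin> Pair m ` S" for n \<gamma>
    using that assms(2)[of \<gamma> n] assms(3)[of n \<gamma>] by (cases "\<gamma> \<in> S"; cases "n = m") auto
  have "formal_sum (\<lambda>(n, \<gamma>). c \<gamma> n) (\<lambda>(n, \<gamma>). F n \<gamma>) m \<beta> =
      (\<Sum>x\<in>Pair m ` S. c (snd x) (fst x) * F (fst x) (snd x) m \<beta>)"
    unfolding formal_sum_def case_prod_unfold
  proof (rule Sum_any.expand_superset)
    show "{x. c (snd x) (fst x) * F (fst x) (snd x) m \<beta> \<noteq> 0} \<subseteq> Pair m ` S"
      using zero by (metis (mono_tags, lifting) mem_Collect_eq prod.collapse subsetI)
  qed (use assms(1) in simp)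
  also have "\<dots> = (\<Sum>\<gamma>\<in>S. c \<gamma> m * F m \<gamma> m \<beta>)"
    by (subst sum.reindex) (auto simp: inj_on_def)
  finally show ?thesis .
qed

text \<open>The decomposition into the single order \<open>\<gamma>\<close> gives a value. Any other
  decomposition has the same coefficients of order \<open>\<beta>\<close> by independence, and only
  these enter the image.\<close>

lemma skip_ser_log_comb:
  assumes "\<beta> \<noteq> 0" "degree_bounded c0"
  shows "skip_ser \<alpha> \<beta> (log_comb c0 \<gamma>) = (if \<beta> = \<gamma> then log_comb c0 \<alpha> else zero_ser)"
  unfolding skip_ser_def
proof (rule the_equality)
  let ?skip = "\<lambda>n \<delta>. if \<beta> = \<delta> then harmonic_log n \<alpha> else zero_ser"
  define c where "c \<delta> = (if \<delta> = \<gamma> then c0 else (\<lambda>n. 0))" for \<delta>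
  have "{\<delta>. \<exists>n. c \<delta> n \<noteq> 0} \<subseteq> {\<gamma>}" by (auto simp: c_def)
  then have fin: "finite {\<delta>. \<exists>n. c \<delta> n \<noteq> 0}" by (rule finite_subset) simp
  have bdd: "\<forall>\<delta>. degree_bounded (c \<delta>)"
    using assms(2) by (auto simp: c_def degree_bounded_def)
  have f: "log_comb c0 \<gamma> = formal_sum (\<lambda>(n, \<delta>). c \<delta> n) (\<lambda>(n, \<delta>). harmonic_log n \<delta>)"
    by (intro ext, subst formal_sum_pairs[of "{\<gamma>}"]) (auto simp: c_def log_comb_def harmonic_log_eq)
  have g: "(if \<beta> = \<gamma> then log_comb c0 \<alpha> else zero_ser) =
      formal_sum (\<lambda>(n, \<delta>). c \<delta> n) (\<lambda>(n, \<delta>). ?skip n \<delta>)"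
    by (intro ext, subst formal_sum_pairs[of "{\<gamma>}"])
       (auto simp: c_def log_comb_def harmonic_log_eq zero_ser_def)
  show "\<exists>c. finite {\<delta>. \<exists>n. c \<delta> n \<noteq> 0} \<and> (\<forall>\<delta>. degree_bounded (c \<delta>)) \<and>
     log_comb c0 \<gamma> = formal_sum (\<lambda>(n, \<delta>). c \<delta> n) (\<lambda>(n, \<delta>). harmonic_log n \<delta>) \<and>
     (if \<beta> = \<gamma> then log_comb c0 \<alpha> else zero_ser) =
       formal_sum (\<lambda>(n, \<delta>). c \<delta> n) (\<lambda>(n, \<delta>). ?skip n \<delta>)"
    using fin bdd f g by blast
next
  fix g
  let ?skip = "\<lambda>n \<delta>. if \<beta> = \<delta> then harmonic_log n \<alpha> else zero_ser"
  assume "\<exists>c. finite {\<delta>. \<exists>n. c \<delta> n \<noteq> 0} \<and> (\<forall>\<delta>. degree_bounded (c \<delta>)) \<and>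
     log_comb c0 \<gamma> = formal_sum (\<lambda>(n, \<delta>). c \<delta> n) (\<lambda>(n, \<delta>). harmonic_log n \<delta>) \<and>
     g = formal_sum (\<lambda>(n, \<delta>). c \<delta> n) (\<lambda>(n, \<delta>). ?skip n \<delta>)"
  then obtain c where c: "finite {\<delta>. \<exists>n. c \<delta> n \<noteq> 0}"
    and f: "log_comb c0 \<gamma> = formal_sum (\<lambda>(n, \<delta>). c \<delta> n) (\<lambda>(n, \<delta>). harmonic_log n \<delta>)"
    and g: "g = formal_sum (\<lambda>(n, \<delta>). c \<delta> n) (\<lambda>(n, \<delta>). ?skip n \<delta>)" by blast
  define S where "S = insert \<beta> (insert \<gamma> {\<delta>. \<exists>n. c \<delta> n \<noteq> 0})"
  have S: "finite S" "\<beta> \<in> S" "\<gamma> \<in> S" "\<And>\<delta> n. \<delta> \<notin> S \<Longrightarrow> c \<delta> n = 0"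
    using c by (auto simp: S_def)
  have cb: "c \<beta> m = (if \<beta> = \<gamma> then c0 m else 0)" for m
  proof -
    \<comment> \<open>Order zero is left out in negative degree: its harmonic logarithm vanishes
      there, so its coefficient is arbitrary. As \<open>\<beta> \<noteq> 0\<close>, the order
      \<open>\<beta>\<close> remains.\<close>
    define T where "T = {\<delta>\<in>S. m \<ge> 0 \<or> \<delta> \<noteq> 0}"
    define d where "d \<delta> = c \<delta> m - (if \<delta> = \<gamma> then c0 m else 0)" for \<delta>
    have "(\<Sum>\<delta>\<in>T. d \<delta> * harmonic_log m \<delta> m \<beta>') = 0" for \<beta>'
    proof -
      have "(\<Sum>\<delta>\<in>T. d \<delta> * harmonic_log m \<delta> m \<beta>') = (\<Sum>\<delta>\<in>S. d \<delta> * harmonic_log m \<delta> m \<beta>')"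
        by (rule sum.mono_neutral_left) (use S in \<open>auto simp: T_def harmonic_log_0\<close>)
      also have "\<dots> = (\<Sum>\<delta>\<in>S. c \<delta> m * harmonic_log m \<delta> m \<beta>') -
          (\<Sum>\<delta>\<in>S. if \<delta> = \<gamma> then c0 m * harmonic_log m \<delta> m \<beta>' else 0)"
        unfolding sum_subtractf[symmetric]
        by (intro sum.cong refl) (simp add: d_def algebra_simps)
      also have "(\<Sum>\<delta>\<in>S. c \<delta> m * harmonic_log m \<delta> m \<beta>') = log_comb c0 \<gamma> m \<beta>'"
        unfolding f by (rule formal_sum_pairs[symmetric]) (use S in \<open>auto simp: harmonic_log_eq\<close>)
      finally show ?thesis using S by (simp add: log_comb_def sum.delta)
    qed
    then have "d \<beta> = 0"
      by (intro harmonic_log_independent[of T m d \<beta>]) (use S assms(1) in \<open>auto simp: T_def\<close>)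
    then show ?thesis by (simp add: d_def)
  qed
  show "g = (if \<beta> = \<gamma> then log_comb c0 \<alpha> else zero_ser)"
  proof (intro ext)
    fix m \<beta>'
    have "g m \<beta>' = (\<Sum>\<delta>\<in>S. c \<delta> m * ?skip m \<delta> m \<beta>')"
      unfolding g by (rule formal_sum_pairs) (use S in \<open>auto simp: harmonic_log_eq zero_ser_def\<close>)
    also have "\<dots> = (\<Sum>\<delta>\<in>S. if \<beta> = \<delta> then c \<beta> m * harmonic_log m \<alpha> m \<beta>' else 0)"
      by (intro sum.cong refl) (auto simp: zero_ser_def)
    also have "\<dots> = c \<beta> m * harmonic_log m \<alpha> m \<beta>'" using S by (simp add: sum.delta')
    finally show "g m \<beta>' = (if \<beta> = \<gamma> then log_comb c0 \<alpha> else zero_ser) m \<beta>'"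
      by (simp add: cb log_comb_def zero_ser_def)
  qed
qed

subsection \<open>Sequences of binomial type\<close>

text \<open>At \<open>a = 0\<close> the induction hypothesis removes all terms except
  \<open>k = 0\<close> and \<open>k = n\<close>. For \<open>n > 0\<close> this reads
  \<open>q n = q n + (q n)(0) * q 0\<close>.\<close>

lemma binomial_type_coeff_0:
  assumes "binomial_type q"
  shows "coeff (q n) 0 = (if n = 0 then 1 else 0)"
proof (induction n rule: less_induct)
  case (less n)
  let ?f = "\<lambda>k. smult (of_nat (n choose k) * poly (q k) 0) (q (n - k))"
  have "pcompose (q n) [:0, 1:] = (\<Sum>k\<le>n. ?f k)"
    using assms unfolding binomial_type_def by blast
  then have "q n = (\<Sum>k\<le>n. ?f k)" by (simp add: pcompose_idR)
  also have "\<dots> = (\<Sum>k\<in>{0, n}. ?f k)"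
    by (rule sum.mono_neutral_right) (auto simp: poly_0_coeff_0 less.IH)
  finally have eq: "q n = (\<Sum>k\<in>{0, n}. ?f k)" .
  have q0: "q 0 \<noteq> 0" "degree (q 0) = 0" using assms unfolding binomial_type_def by auto
  show ?case
  proof (cases "n = 0")
    case True
    then have "smult 1 (q 0) = smult (coeff (q 0) 0) (q 0)"
      using eq by (simp add: poly_0_coeff_0)
    then have "smult (1 - coeff (q 0) 0) (q 0) = 0" by (simp only: smult_diff_left) simp
    then show ?thesis using q0 True by simp
  next
    case False
    then have "q n = q n + smult (coeff (q n) 0) (q 0)"
      using eq less.IH[of 0] by (simp add: poly_0_coeff_0)
    then show ?thesis using q0 False by simp
  qed
qed

text \<open>Taking the coefficient of \<open>x\<close> in the binomial identity expresses the
  derivative of \<open>q n\<close> at \<open>a\<close> by the values of the \<open>q k\<close> at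
  \<open>a\<close>; then the coefficients of \<open>a^i\<close> are compared.\<close>

lemma binomial_type_coeff_Suc:
  assumes "binomial_type q"
  shows "of_nat (Suc i) * coeff (q n) (Suc i) =
    (\<Sum>k\<le>n. of_nat (n choose k) * coeff (q k) i * coeff (q (n - k)) 1)"
proof -
  have coeff1: "coeff p 1 = poly (pderiv p) 0" for p :: "complex poly"
    by (simp add: poly_0_coeff_0 coeff_pderiv)
  have eq: "poly (pderiv (q n)) a =
      poly (\<Sum>k\<le>n. smult (of_nat (n choose k) * coeff (q (n - k)) 1) (q k)) a" for a
  proof -
    have "poly (pderiv (q n)) a = coeff (pcompose (q n) [:a, 1:]) 1"
      unfolding coeff1 by (simp add: pderiv_pcompose poly_pcompose pderiv_pCons)
    also have "pcompose (q n) [:a, 1:] =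
        (\<Sum>k\<le>n. smult (of_nat (n choose k) * poly (q k) a) (q (n - k)))"
      using assms unfolding binomial_type_def by blast
    finally show ?thesis by (simp add: coeff_sum poly_sum mult_ac)
  qed
  have "pderiv (q n) = (\<Sum>k\<le>n. smult (of_nat (n choose k) * coeff (q (n - k)) 1) (q k))"
    by (rule poly_eq_poly_eq_iff[THEN iffD1, OF ext[OF eq]])
  then have "coeff (pderiv (q n)) i =
      coeff (\<Sum>k\<le>n. smult (of_nat (n choose k) * coeff (q (n - k)) 1) (q k)) i" by simp
  then show ?thesis by (simp add: coeff_pderiv coeff_sum mult_ac)
qed

text \<open>The series \<open>g\<close> with \<open>\<Sum>\<^sub>n q\<^sub>n(x) t\<^sup>n / n! = exp (x g(t))\<close>.\<close>

definition umbral_fps :: "(nat \<Rightarrow> complex poly) \<Rightarrow> complex fps" where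
  "umbral_fps q = Abs_fps (\<lambda>k. coeff (q k) 1 / fact k)"

text \<open>After division by factorials, \<open>binomial_type_coeff_Suc\<close> is the Cauchy
  product with one more factor \<open>umbral_fps q\<close>.\<close>

lemma umbral_fps_power_nth:
  assumes "binomial_type q"
  shows "fps_nth (umbral_fps q ^ i) k = coeff (q k) i * fact i / fact k"
proof (induction i arbitrary: k)
  case 0
  then show ?case using binomial_type_coeff_0[OF assms, of k] by simp
next
  case (Suc i)
  have "fps_nth (umbral_fps q ^ Suc i) k = fps_nth (umbral_fps q ^ i * umbral_fps q) k"
    by (simp add: mult.commute)
  also have "\<dots> = (\<Sum>j=0..k. coeff (q j) i * fact i / fact j * (coeff (q (k - j)) 1 / fact (k - j)))"
    unfolding fps_mult_nth Suc.IH by (simp add: umbral_fps_def)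
  also have "\<dots> = fact i / fact k *
      (\<Sum>j\<le>k. of_nat (k choose j) * coeff (q j) i * coeff (q (k - j)) 1)"
    unfolding sum_distrib_left atLeast0AtMost
    by (intro sum.cong refl) (simp add: binomial_fact field_simps)
  also have "\<dots> = fact i / fact k * (of_nat (Suc i) * coeff (q k) (Suc i))"
    by (simp only: binomial_type_coeff_Suc[OF assms])
  finally show ?case by (simp add: mult_ac)
qed

lemma umbral_fps_nth_0: "binomial_type q \<Longrightarrow> fps_nth (umbral_fps q) 0 = 0"
proof -
  assume "binomial_type q"
  then have "degree (q 0) = 0" unfolding binomial_type_def by blast
  then show ?thesis by (simp add: umbral_fps_def coeff_eq_0)
qed

lemma umbral_fps_nth_1: "binomial_type q \<Longrightarrow> fps_nth (umbral_fps q) 1 \<noteq> 0"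
proof -
  assume "binomial_type q"
  then have "degree (q 1) = 1" "q 1 \<noteq> 0" unfolding binomial_type_def by blast+
  then have "coeff (q 1) 1 \<noteq> 0" by (metis leading_coeff_0_iff)
  then show ?thesis by (simp add: umbral_fps_def)
qed

section \<open>Integer powers of invertible power series\<close>

definition fps_pow_int :: "complex fps \<Rightarrow> int \<Rightarrow> complex fps" where
  "fps_pow_int G k = (if k \<ge> 0 then G ^ nat k else inverse G ^ nat (- k))"

lemma fps_pow_int_Suc:
  assumes "fps_nth G 0 \<noteq> 0"
  shows "fps_pow_int G (k + 1) = G * fps_pow_int G k"
proof (cases "k \<ge> 0")
  case True
  then show ?thesis by (simp add: fps_pow_int_def nat_add_distrib)
next
  case False
  then have "nat (- k) = Suc (nat (- (k + 1)))" by simp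
  then have "fps_pow_int G k = inverse G * fps_pow_int G (k + 1)"
    using False by (cases "k = - 1") (simp_all add: fps_pow_int_def)
  moreover have "G * (inverse G * X) = X" for X
    using inverse_mult_eq_1'[OF assms] by (simp flip: mult.assoc)
  ultimately show ?thesis by metis
qed

lemma fps_pow_int_add:
  assumes "fps_nth G 0 \<noteq> 0"
  shows "fps_pow_int G (k + int i) = G ^ i * fps_pow_int G k"
proof (induction i)
  case (Suc i)
  then show ?case using fps_pow_int_Suc[OF assms, of "k + int i"] by (simp add: add_ac mult_ac)
qed simp

lemma fps_pow_int_nth_0:
  assumes "fps_nth G 0 \<noteq> 0"
  shows "fps_nth (fps_pow_int G k) 0 \<noteq> 0"
  using assms by (simp add: fps_pow_int_def fps_nth_power_0)

text \<open>The coefficient of \<open>t\<^sup>n\<close> in the Laurent series \<open>g\<^sup>k\<close>, for integers \<open>n\<close> and \<open>k\<close>.  Extending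
  \<open>k\<close> from the natural numbers to the integers is what extends \<open>q\<close> to a logarithmic sequence.\<close>

definition umbral_coeff :: "complex fps \<Rightarrow> int \<Rightarrow> int \<Rightarrow> complex" where
  "umbral_coeff g n k = (if k \<le> n then fps_nth (fps_pow_int (fps_shift 1 g) k) (nat (n - k)) else 0)"

context
  fixes g :: "complex fps"
  assumes g0: "fps_nth g 0 = 0" and g1: "fps_nth g 1 \<noteq> 0"
begin

text \<open>As \<open>g\<close> has no constant term, it is \<open>t\<close> times its shift, which
  is invertible. This is why \<open>umbral_coeff\<close> reads the coefficient of \<open>t^n\<close>
  in \<open>g^k\<close> at position \<open>n - k\<close> of a power of the shift.\<close>

lemma fps_power_eq_shift: "g ^ i = fps_X ^ i * fps_shift 1 g ^ i"
proof -
  have "g = fps_X * fps_shift 1 g"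
    using g0 by (simp add: fps_eq_iff)
  then show ?thesis by (metis power_mult_distrib)
qed

lemma umbral_coeff_diag: "umbral_coeff g n n \<noteq> 0"
  using g1 by (simp add: umbral_coeff_def fps_pow_int_nth_0)

lemma umbral_coeff_nonneg:
  assumes "k \<ge> 0"
  shows "umbral_coeff g n k = (if n < 0 then 0 else fps_nth (g ^ nat k) (nat n))"
proof -
  have "umbral_coeff g n k = fps_nth (g ^ nat k) (nat n)" if "n \<ge> 0"
    unfolding fps_power_eq_shift fps_X_power_mult_nth
    using assms that by (auto simp: umbral_coeff_def fps_pow_int_def nat_diff_distrib)
  moreover have "umbral_coeff g n k = 0" if "n < 0"
    using assms that by (simp add: umbral_coeff_def)
  ultimately show ?thesis by simp
qed

text \<open>The Cauchy product for \<open>g^(m+i) = g^i * g^m\<close>; it stops at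
  \<open>k = n - m\<close> because \<open>g^m\<close> starts with \<open>t^m\<close>.\<close>

lemma umbral_coeff_add:
  assumes "m \<le> n"
  shows "umbral_coeff g n (m + int i) =
    (\<Sum>k\<le>nat (n - m). fps_nth (g ^ i) k * umbral_coeff g (n - int k) m)"
proof -
  define G where "G = fps_shift 1 g"
  have G0: "fps_nth G 0 \<noteq> 0" using g1 by (simp add: G_def)
  define N where "N = nat (n - m)"
  have "(\<Sum>k\<le>N. fps_nth (g ^ i) k * umbral_coeff g (n - int k) m) =
      (\<Sum>k\<le>N. fps_nth (g ^ i) k * fps_nth (fps_pow_int G m) (N - k))"
  proof (intro sum.cong refl)
    fix k assume "k \<in> {..N}"
    then have "m \<le> n - int k" "nat (n - int k - m) = N - k"
      using assms by (auto simp: N_def)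
    then show "fps_nth (g ^ i) k * umbral_coeff g (n - int k) m =
        fps_nth (g ^ i) k * fps_nth (fps_pow_int G m) (N - k)"
      by (simp add: umbral_coeff_def G_def)
  qed
  also have "\<dots> = fps_nth (g ^ i * fps_pow_int G m) N"
    by (simp add: fps_mult_nth atLeast0AtMost)
  also have "g ^ i * fps_pow_int G m = fps_X ^ i * fps_pow_int G (m + int i)"
    unfolding fps_power_eq_shift fps_pow_int_add[OF G0] by (simp add: G_def mult.assoc)
  also have "fps_nth \<dots> N = umbral_coeff g n (m + int i)"
  proof -
    have "N < i \<longleftrightarrow> \<not> m + int i \<le> n" "nat (n - (m + int i)) = N - i"
      using assms by (auto simp: N_def)
    then show ?thesis
      unfolding fps_X_power_mult_nth by (auto simp: umbral_coeff_def G_def)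
  qed
  finally show ?thesis by (simp add: N_def)
qed

text \<open>Descend through the columns below zero. If column \<open>m + 1\<close> vanishes,
  consider the recurrence for row \<open>n + 1\<close>: its term \<open>k = 0\<close> has the factor
  \<open>g_0 = 0\<close>, its terms with \<open>k \<ge> 2\<close> lie in earlier rows, and
  \<open>k = 1\<close> leaves \<open>d n m\<close> with the nonzero factor
  \<open>g_1\<close>.\<close>

lemma umbral_recurrence_unique:
  fixes d :: "int \<Rightarrow> int \<Rightarrow> complex"
  assumes nonneg: "\<And>n k. k \<ge> 0 \<Longrightarrow> d n k = 0"
    and deg: "\<And>n k. k > n \<Longrightarrow> d n k = 0"
    and rec: "\<And>n m. m < n \<Longrightarrow> d n (m + 1) = (\<Sum>k\<le>nat (n - m). fps_nth g k * d (n - int k) m)"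
  shows "d n k = 0"
proof -
  have "d n (- int j) = 0" for n j
  proof (induction j arbitrary: n)
    case 0
    then show ?case using nonneg by simp
  next
    case (Suc j)
    define m where "m = - int (Suc j)"
    have IH: "d n (m + 1) = 0" for n using Suc.IH by (simp add: m_def)
    have "d n m = 0"
    proof (induction "nat (n - m)" arbitrary: n rule: less_induct)
      case less
      show ?case
      proof (cases "n < m")
        case False
        define N where "N = nat (n + 1 - m)"
        have "N \<ge> 1" using False by (simp add: N_def)
        have "0 = (\<Sum>k\<le>N. fps_nth g k * d (n + 1 - int k) m)"
          using rec[of m "n + 1"] IH False by (simp add: N_def)
        also have "\<dots> = (\<Sum>k\<in>{1}. fps_nth g k * d (n + 1 - int k) m)"
        proof (rule sum.mono_neutral_right)
          show "\<forall>k\<in>{..N} - {1}. fps_nth g k * d (n + 1 - int k) m = 0"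
          proof
            fix k assume k: "k \<in> {..N} - {1}"
            show "fps_nth g k * d (n + 1 - int k) m = 0"
            proof (cases "k = 0")
              case False
              then have "k \<ge> 2" using k by (cases k) auto
              show ?thesis
              proof (cases "n = m")
                case True
                then show ?thesis using deg[of "n + 1 - int k" m] \<open>k \<ge> 2\<close> by simp
              next
                case False
                then have "nat (n + 1 - int k - m) < nat (n - m)"
                  using \<open>\<not> n < m\<close> \<open>k \<ge> 2\<close> by simp
                then show ?thesis using less by simp
              qed
            qed (simp add: g0)
          qed
        qed (use \<open>N \<ge> 1\<close> in auto)
        finally show ?thesis using g1 by simp
      qed (rule deg)
    qed
    then show ?case by (simp add: m_def)
  qed
  then show ?thesis using nonneg[of k n] by (metis int_cases4 nle_le of_nat_0_le_iff)
qed

end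

text \<open>The coefficient of \<open>t^k\<close> in \<open>exp (a g(t))\<close>. The bound
  \<open>N\<close> may exceed \<open>k\<close>, so that one bound serves all \<open>k\<close> when
  sums are swapped.\<close>

lemma poly_eq_sum_umbral_fps:
  assumes "binomial_type q" "k \<le> N"
  shows "poly (q k) a / fact k = (\<Sum>i\<le>N. fps_nth (umbral_fps q ^ i) k * (a ^ i / fact i))"
proof -
  have deg: "degree (q k) = k" using assms unfolding binomial_type_def by blast
  have "poly (q k) a = (\<Sum>i\<le>k. coeff (q k) i * a ^ i)" by (simp add: poly_altdef deg)
  also have "\<dots> = (\<Sum>i\<le>N. coeff (q k) i * a ^ i)"
    by (rule sum.mono_neutral_left) (use assms(2) in \<open>auto simp: coeff_eq_0 deg\<close>)
  finally show ?thesis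
    by (simp add: umbral_fps_power_nth[OF assms(1)] sum_divide_distrib)
qed

text \<open>Both sides are the coefficient of \<open>t^n\<close> in
  \<open>exp (a g(t)) * g(t)^m\<close>, expanded by powers of \<open>a\<close> on the left and by
  powers of \<open>t\<close> in the exponential on the right.\<close>

lemma umbral_coeff_binomial:
  assumes "binomial_type q" "m \<le> n"
  shows "(\<Sum>i\<le>nat (n - m). a ^ i / fact i * umbral_coeff (umbral_fps q) n (m + int i)) =
    (\<Sum>k\<le>nat (n - m). poly (q k) a / fact k * umbral_coeff (umbral_fps q) (n - int k) m)"
proof -
  let ?g = "umbral_fps q" and ?N = "nat (n - m)"
  note g = umbral_fps_nth_0[OF assms(1)] umbral_fps_nth_1[OF assms(1)]
  have "(\<Sum>i\<le>?N. a ^ i / fact i * umbral_coeff ?g n (m + int i)) =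
      (\<Sum>i\<le>?N. \<Sum>k\<le>?N. fps_nth (?g ^ i) k * (a ^ i / fact i) * umbral_coeff ?g (n - int k) m)"
    by (simp add: umbral_coeff_add[OF g assms(2)] sum_distrib_left mult_ac)
  also have "\<dots> = (\<Sum>k\<le>?N. \<Sum>i\<le>?N. fps_nth (?g ^ i) k * (a ^ i / fact i) * umbral_coeff ?g (n - int k) m)"
    by (rule sum.swap)
  also have "\<dots> = (\<Sum>k\<le>?N. poly (q k) a / fact k * umbral_coeff ?g (n - int k) m)"
    by (intro sum.cong refl)
       (simp only: poly_eq_sum_umbral_fps[OF assms(1), of _ ?N] sum_distrib_right atMost_iff)
  finally show ?thesis .
qed

section \<open>The binomial law in terms of coefficients\<close>

lemma shift_ser_log_comb:
  assumes "\<And>k. k > n \<Longrightarrow> c k = 0"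
  shows "shift_ser a (log_comb c \<alpha>) = log_comb (\<lambda>m. \<Sum>i\<le>nat (n - m).
    a ^ i / fact i * (roman_fact (m + int i) / roman_fact m * c (m + int i))) \<alpha>"
proof (intro ext)
  fix m \<beta>
  let ?t = "\<lambda>i. a ^ i / fact i * (roman_fact (m + int i) / roman_fact m * c (m + int i))"
  have "shift_ser a (log_comb c \<alpha>) m \<beta> = Sum_any (\<lambda>i. ?t i * harmonic_log m \<alpha> m \<beta>)"
    unfolding shift_ser_def formal_sum_def funpow_D_ser_log_comb by (simp add: log_comb_def mult.assoc)
  also have "\<dots> = (\<Sum>i\<le>nat (n - m). ?t i * harmonic_log m \<alpha> m \<beta>)"
  proof (rule Sum_any.expand_superset)
    show "{i. ?t i * harmonic_log m \<alpha> m \<beta> \<noteq> 0} \<subseteq> {..nat (n - m)}"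
    proof
      fix i assume "i \<in> {i. ?t i * harmonic_log m \<alpha> m \<beta> \<noteq> 0}"
      then have "c (m + int i) \<noteq> 0" by auto
      then have "m + int i \<le> n" using assms not_less by blast
      then show "i \<in> {..nat (n - m)}" by simp
    qed
  qed simp
  finally show "shift_ser a (log_comb c \<alpha>) m \<beta> = log_comb (\<lambda>m. \<Sum>i\<le>nat (n - m).
    a ^ i / fact i * (roman_fact (m + int i) / roman_fact m * c (m + int i))) \<alpha> m \<beta>"
    by (simp add: log_comb_def sum_distrib_right)
qed

lemma formal_sum_log_comb:
  fixes d :: "nat \<Rightarrow> complex"
  assumes "\<And>k m. m > n - int k \<Longrightarrow> c k m = 0"
  shows "formal_sum d (\<lambda>k. log_comb (c k) \<alpha>) = log_comb (\<lambda>m. \<Sum>k\<le>nat (n - m). d k * c k m) \<alpha>"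
proof (intro ext)
  fix m \<beta>
  have "formal_sum d (\<lambda>k. log_comb (c k) \<alpha>) m \<beta> =
      (\<Sum>k\<le>nat (n - m). d k * (c k m * harmonic_log m \<alpha> m \<beta>))"
    unfolding formal_sum_def log_comb_def
  proof (rule Sum_any.expand_superset)
    show "{k. d k * (c k m * harmonic_log m \<alpha> m \<beta>) \<noteq> 0} \<subseteq> {..nat (n - m)}"
    proof
      fix k assume "k \<in> {k. d k * (c k m * harmonic_log m \<alpha> m \<beta>) \<noteq> 0}"
      then have "c k m \<noteq> 0" by auto
      then have "m \<le> n - int k" using assms not_less by blast
      then show "k \<in> {..nat (n - m)}" by simp
    qed
  qed simp
  then show "formal_sum d (\<lambda>k. log_comb (c k) \<alpha>) m \<beta> =
      log_comb (\<lambda>m. \<Sum>k\<le>nat (n - m). d k * c k m) \<alpha> m \<beta>"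
    by (simp add: log_comb_def sum_distrib_right mult.assoc)
qed

text \<open>For nonzero order every harmonic logarithm is nonzero, so each coefficient can be read
  off at a leading monomial.\<close>

lemma log_comb_eqD:
  assumes "log_comb c \<alpha> = log_comb c' \<alpha>" "\<alpha> \<noteq> 0"
  shows "c = c'"
proof
  fix n
  have "log_comb c \<alpha> n (lead_vec n \<alpha>) = log_comb c' \<alpha> n (lead_vec n \<alpha>)" using assms by simp
  then show "c n = c' n" using harmonic_log_lead_vec_neq_0[of n \<alpha>] assms(2) by (simp add: log_comb_def)
qed

lemma log_comb_0:
  "log_comb c 0 m \<beta> = (if m \<ge> 0 \<and> \<beta> = 0 then c m else 0)"
  by (simp add: log_comb_def harmonic_log_0)

lemma poly_ser_eq: "poly_ser p m \<beta> = (if m \<ge> 0 \<and> \<beta> = 0 then coeff p (nat m) else 0)"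
  unfolding poly_ser_def formal_sum_def
  by (subst Sum_any_singleton[of "nat m"]) (auto simp: ell_def)

text \<open>The Roman factorials convert from the basis
  \<open>\<lambda>_k / \<lfloor>k\<rceil>!\<close>, on which \<open>D\<close> just shifts the index,
  to the \<open>\<lambda>_k\<close>.\<close>

definition umbral_log_coeff :: "(nat \<Rightarrow> complex poly) \<Rightarrow> int \<Rightarrow> int \<Rightarrow> complex" where
  "umbral_log_coeff q n k = roman_fact n / roman_fact k * umbral_coeff (umbral_fps q) n k"

lemma umbral_log_coeff_eq_0: "k > n \<Longrightarrow> umbral_log_coeff q n k = 0"
  by (simp add: umbral_log_coeff_def umbral_coeff_def)

lemma umbral_log_coeff_nonneg:
  assumes "binomial_type q" "k \<ge> 0"
  shows "umbral_log_coeff q n k = (if n < 0 then 0 else coeff (q (nat n)) (nat k))"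
proof -
  have "roman_fact n = fact (nat n)" if "n \<ge> 0" for n using that by (simp add: roman_fact_def)
  then show ?thesis using assms(2)
    by (simp add: umbral_log_coeff_def umbral_fps_power_nth[OF assms(1)]
      umbral_coeff_nonneg[OF umbral_fps_nth_0 umbral_fps_nth_1, OF assms(1) assms(1)])
qed

text \<open>Order zero sees exactly the coefficients with \<open>k \<ge> 0\<close>; those with
  \<open>k < 0\<close> have to come from the binomial law.\<close>

lemma log_comb_0_eq_poly_ser_iff:
  assumes "binomial_type q"
  shows "log_comb c 0 = (if n < 0 then zero_ser else poly_ser (q (nat n))) \<longleftrightarrow>
    (\<forall>k\<ge>0. c k = umbral_log_coeff q n k)"
proof
  assume *: "log_comb c 0 = (if n < 0 then zero_ser else poly_ser (q (nat n)))"
  show "\<forall>k\<ge>0. c k = umbral_log_coeff q n k"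
  proof (intro allI impI)
    fix k :: int
    assume "k \<ge> 0"
    then show "c k = umbral_log_coeff q n k"
      using fun_cong[OF fun_cong[OF *], of k 0]
      by (simp add: log_comb_0 poly_ser_eq zero_ser_def umbral_log_coeff_nonneg[OF assms]
          split: if_splits)
  qed
next
  assume "\<forall>k\<ge>0. c k = umbral_log_coeff q n k"
  then show "log_comb c 0 = (if n < 0 then zero_ser else poly_ser (q (nat n)))"
    by (intro ext) (simp add: log_comb_0 poly_ser_eq zero_ser_def umbral_log_coeff_nonneg[OF assms])
qed

text \<open>Condition (ii) compared at each degree \<open>m\<close>, for a coefficient array shared
  by all orders: the shift by \<open>a\<close> on the left, the binomial sum on the right.\<close>

definition binomial_law :: "(nat \<Rightarrow> complex poly) \<Rightarrow> (int \<Rightarrow> int \<Rightarrow> complex) \<Rightarrow> bool" where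
  "binomial_law q c \<longleftrightarrow> (\<forall>n a m.
     (\<Sum>i\<le>nat (n - m). a ^ i / fact i * (roman_fact (m + int i) / roman_fact m * c n (m + int i))) =
     (\<Sum>k\<le>nat (n - m). roman_fact n / (roman_fact (int k) * roman_fact (n - int k)) * poly (q k) a *
        c (n - int k) m))"

lemma shift_ser_log_comb_binomial_law:
  assumes deg: "\<And>n k. k > n \<Longrightarrow> c n k = 0"
  shows "binomial_law q c \<Longrightarrow> shift_ser a (log_comb (c n) \<alpha>) =
        formal_sum (\<lambda>k::nat. roman_fact n / (roman_fact (int k) * roman_fact (n - int k)) * poly (q k) a)
          (\<lambda>k. log_comb (c (n - int k)) \<alpha>)"
    and "\<alpha> \<noteq> 0 \<Longrightarrow> (\<And>n a. shift_ser a (log_comb (c n) \<alpha>) =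
        formal_sum (\<lambda>k::nat. roman_fact n / (roman_fact (int k) * roman_fact (n - int k)) * poly (q k) a)
          (\<lambda>k. log_comb (c (n - int k)) \<alpha>)) \<Longrightarrow> binomial_law q c"
proof -
  define L where "L n a = (\<lambda>m. \<Sum>i\<le>nat (n - m).
     a ^ i / fact i * (roman_fact (m + int i) / roman_fact m * c n (m + int i)))" for n a
  define R where "R n a = (\<lambda>m. \<Sum>k\<le>nat (n - m).
     roman_fact n / (roman_fact (int k) * roman_fact (n - int k)) * poly (q k) a * c (n - int k) m)"
    for n a
  have L: "shift_ser a (log_comb (c n) \<alpha>) = log_comb (L n a) \<alpha>" for n a
    unfolding L_def by (rule shift_ser_log_comb) (rule deg)
  have R: "formal_sum
        (\<lambda>k::nat. roman_fact n / (roman_fact (int k) * roman_fact (n - int k)) * poly (q k) a)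
        (\<lambda>k. log_comb (c (n - int k)) \<alpha>) = log_comb (R n a) \<alpha>" for n a
    unfolding R_def by (rule formal_sum_log_comb) (rule deg)
  have law: "binomial_law q c \<longleftrightarrow> (\<forall>n a. L n a = R n a)"
    by (simp only: binomial_law_def L_def R_def fun_eq_iff)
  show "binomial_law q c \<Longrightarrow> shift_ser a (log_comb (c n) \<alpha>) =
        formal_sum (\<lambda>k::nat. roman_fact n / (roman_fact (int k) * roman_fact (n - int k)) * poly (q k) a)
          (\<lambda>k. log_comb (c (n - int k)) \<alpha>)"
    unfolding L R law by simp
  assume "\<alpha> \<noteq> 0" and *: "\<And>n a. shift_ser a (log_comb (c n) \<alpha>) =
        formal_sum (\<lambda>k::nat. roman_fact n / (roman_fact (int k) * roman_fact (n - int k)) * poly (q k) a)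
          (\<lambda>k. log_comb (c (n - int k)) \<alpha>)"
  show "binomial_law q c"
    unfolding law using log_comb_eqD[OF *[unfolded L R] \<open>\<alpha> \<noteq> 0\<close>] by blast
qed

lemma binomial_law_umbral_log_coeff:
  assumes "binomial_type q"
  shows "binomial_law q (umbral_log_coeff q)"
  unfolding binomial_law_def
proof (intro allI)
  fix n a m
  let ?g = "umbral_fps q" and ?N = "nat (n - m)"
  have eq: "(\<Sum>i\<le>?N. a ^ i / fact i * umbral_coeff ?g n (m + int i)) =
    (\<Sum>k\<le>?N. poly (q k) a / fact k * umbral_coeff ?g (n - int k) m)"
  proof (cases "m \<le> n")
    case True
    then show ?thesis by (rule umbral_coeff_binomial[OF assms])
  next
    \<comment> \<open>Here \<open>nat (n - m)\<close> is \<open>0\<close>, and the one term left on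
      each side contains an entry with \<open>m > n\<close>, which is zero.\<close>
    case False
    then show ?thesis by (simp add: umbral_coeff_def)
  qed
  have "(\<Sum>i\<le>?N. a ^ i / fact i *
      (roman_fact (m + int i) / roman_fact m * umbral_log_coeff q n (m + int i))) =
      roman_fact n / roman_fact m * (\<Sum>i\<le>?N. a ^ i / fact i * umbral_coeff ?g n (m + int i))"
    unfolding sum_distrib_left
    by (intro sum.cong refl) (simp add: umbral_log_coeff_def field_simps)
  also have "\<dots> = (\<Sum>k\<le>?N. roman_fact n / (roman_fact (int k) * roman_fact (n - int k)) * poly (q k) a *
        umbral_log_coeff q (n - int k) m)"
    unfolding eq sum_distrib_left
    by (intro sum.cong refl) (simp add: umbral_log_coeff_def)
  finally show "(\<Sum>i\<le>?N. a ^ i / fact i *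
      (roman_fact (m + int i) / roman_fact m * umbral_log_coeff q n (m + int i))) =
      (\<Sum>k\<le>?N. roman_fact n / (roman_fact (int k) * roman_fact (n - int k)) * poly (q k) a *
        umbral_log_coeff q (n - int k) m)" .
qed

text \<open>Both sides of the binomial law are polynomials in \<open>a\<close>; the recurrence compares the
  coefficients of \<open>a\<close>.\<close>

lemma binomial_law_recurrence:
  assumes "binomial_law q c" "m < n"
  shows "c n (m + 1) * roman_fact (m + 1) / roman_fact n = (\<Sum>k\<le>nat (n - m).
    fps_nth (umbral_fps q) k * (c (n - int k) m * roman_fact m / roman_fact (n - int k)))"
proof -
  let ?N = "nat (n - m)"
  \<comment> \<open>These are the coefficients of \<open>p_n / \<lfloor>n\<rceil>!\<close> in the
    basis \<open>\<lambda>_k / \<lfloor>k\<rceil>!\<close>; in them the law loses all Roman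
    factorials except those of natural numbers.\<close>
  let ?z = "\<lambda>n k. c n k * roman_fact k / roman_fact n"
  let ?P = "\<Sum>i\<le>?N. monom (?z n (m + int i) / fact i) i"
  let ?Q = "\<Sum>k\<le>?N. smult (?z (n - int k) m / fact k) (q k)"
  have "poly ?P a = poly ?Q a" for a
  proof -
    have "(\<Sum>i\<le>?N. a ^ i / fact i * (roman_fact (m + int i) / roman_fact m * c n (m + int i))) =
     (\<Sum>k\<le>?N. roman_fact n / (roman_fact (int k) * roman_fact (n - int k)) * poly (q k) a *
        c (n - int k) m)" (is "?L = ?R")
      using assms(1) unfolding binomial_law_def by blast
    moreover have "poly ?P a = roman_fact m / roman_fact n * ?L"
      unfolding sum_distrib_left poly_sum
      by (intro sum.cong refl) (simp add: poly_monom field_simps)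
    moreover have "poly ?Q a = roman_fact m / roman_fact n * ?R"
      unfolding sum_distrib_left poly_sum
      by (intro sum.cong refl) (simp add: field_simps)
    ultimately show ?thesis by simp
  qed
  then have "?P = ?Q" using poly_eq_poly_eq_iff[of ?P ?Q] by blast
  then have "coeff ?P 1 = coeff ?Q 1" by simp
  moreover have "coeff ?P 1 = ?z n (m + 1)"
  proof -
    have "coeff ?P 1 = (\<Sum>i\<le>?N. if i = 1 then ?z n (m + int i) / fact i else 0)"
      unfolding coeff_sum by (intro sum.cong refl) simp
    also have "\<dots> = ?z n (m + 1)"
      using assms(2) by (subst sum.delta) auto
    finally show ?thesis .
  qed
  moreover have "coeff ?Q 1 = (\<Sum>k\<le>?N. fps_nth (umbral_fps q) k * ?z (n - int k) m)"
    unfolding coeff_sum by (intro sum.cong refl) (simp add: umbral_fps_def mult_ac)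
  ultimately show ?thesis by simp
qed

text \<open>Both rescaled arrays satisfy the same linear recurrence, and their difference vanishes
  for \<open>k \<ge> 0\<close> and for \<open>k > n\<close>.\<close>

lemma binomial_law_unique:
  assumes q: "binomial_type q" and c: "binomial_law q c"
    and deg: "\<And>n k. k > n \<Longrightarrow> c n k = 0"
    and nonneg: "\<And>n k. k \<ge> 0 \<Longrightarrow> c n k = umbral_log_coeff q n k"
  shows "c n k = umbral_log_coeff q n k"
proof -
  let ?z = "\<lambda>c n k. c n k * roman_fact k / roman_fact n"
  let ?u = "umbral_log_coeff q"
  define d where "d n k = ?z c n k - ?z ?u n k" for n k
  have "d n k = 0"
  proof (rule umbral_recurrence_unique[OF umbral_fps_nth_0[OF q] umbral_fps_nth_1[OF q]])
    show "d n (m + 1) = (\<Sum>k\<le>nat (n - m). fps_nth (umbral_fps q) k * d (n - int k) m)"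
      if "m < n" for n m
      unfolding d_def binomial_law_recurrence[OF c that]
        binomial_law_recurrence[OF binomial_law_umbral_log_coeff[OF q] that]
      by (simp only: right_diff_distrib sum_subtractf)
  qed (simp_all add: d_def deg nonneg umbral_log_coeff_eq_0)
  then show ?thesis by (simp add: d_def field_simps)
qed

section \<open>Existence and uniqueness of the logarithmic extension\<close>

theorem theorem11:
  fixes q :: "nat \<Rightarrow> complex poly"
  assumes "binomial_type q"
  shows "\<exists>!p :: int \<Rightarrow> logvec \<Rightarrow> logser.
     logarithmic_sequence p \<and>
     (\<forall>n. p n 0 = (if n < 0 then zero_ser else poly_ser (q (nat n)))) \<and>
     (\<forall>\<alpha> n a. shift_ser a (p n \<alpha>) =
        formal_sum
          (\<lambda>k::nat. roman_fact n / (roman_fact (int k) * roman_fact (n - int k)) * poly (q k) a)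
          (\<lambda>k. p (n - int k) \<alpha>)) \<and>
     (\<forall>\<alpha> \<beta> \<gamma> n. \<beta> \<noteq> 0 \<longrightarrow>
        skip_ser \<alpha> \<beta> (p n \<gamma>) = (if \<beta> = \<gamma> then p n \<alpha> else zero_ser))"
proof -
  let ?u = "umbral_log_coeff q"
  let ?p = "\<lambda>n. log_comb (?u n)"
  have u_deg: "?u n k = 0" if "k > n" for n k using that by (rule umbral_log_coeff_eq_0)
  have u_diag: "?u n n \<noteq> 0" for n
    using umbral_coeff_diag[OF umbral_fps_nth_0 umbral_fps_nth_1, OF assms assms]
    by (simp add: umbral_log_coeff_def)
  show ?thesis
  proof (rule ex1I[of _ ?p], intro conjI allI impI)
    show "logarithmic_sequence ?p"
      unfolding logarithmic_sequence_def formal_sum_harmonic_log using u_deg u_diag by blast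
    show "?p n 0 = (if n < 0 then zero_ser else poly_ser (q (nat n)))" for n
      using log_comb_0_eq_poly_ser_iff[OF assms] by blast
    show "shift_ser a (?p n \<alpha>) = formal_sum
          (\<lambda>k::nat. roman_fact n / (roman_fact (int k) * roman_fact (n - int k)) * poly (q k) a)
          (\<lambda>k. ?p (n - int k) \<alpha>)" for \<alpha> n a
      by (rule shift_ser_log_comb_binomial_law(1)[OF u_deg binomial_law_umbral_log_coeff[OF assms]])
    show "skip_ser \<alpha> \<beta> (?p n \<gamma>) = (if \<beta> = \<gamma> then ?p n \<alpha> else zero_ser)" if "\<beta> \<noteq> 0" for \<alpha> \<beta> \<gamma> n
      by (rule skip_ser_log_comb[OF that]) (use u_deg in \<open>auto simp: degree_bounded_def\<close>)
  next
    fix p :: "int \<Rightarrow> logvec \<Rightarrow> logser"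
    assume *: "logarithmic_sequence p \<and>
     (\<forall>n. p n 0 = (if n < 0 then zero_ser else poly_ser (q (nat n)))) \<and>
     (\<forall>\<alpha> n a. shift_ser a (p n \<alpha>) =
        formal_sum
          (\<lambda>k::nat. roman_fact n / (roman_fact (int k) * roman_fact (n - int k)) * poly (q k) a)
          (\<lambda>k. p (n - int k) \<alpha>)) \<and>
     (\<forall>\<alpha> \<beta> \<gamma> n. \<beta> \<noteq> 0 \<longrightarrow>
        skip_ser \<alpha> \<beta> (p n \<gamma>) = (if \<beta> = \<gamma> then p n \<alpha> else zero_ser))"
    \<comment> \<open>A nonzero reference order: its coefficients are determined by the series, and
      skipping from it carries the same array to every order, including zero.\<close>
    define \<gamma> :: logvec where "\<gamma> = ones (Suc 0)"
    have \<gamma>: "\<gamma> \<noteq> 0" by (simp add: \<gamma>_def)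
    have "\<forall>n. \<exists>c. c n \<noteq> 0 \<and> (\<forall>k>n. c k = 0) \<and> p n \<gamma> = log_comb c \<gamma>"
      using * unfolding logarithmic_sequence_def formal_sum_harmonic_log by blast
    then obtain c where deg: "\<And>n k. k > n \<Longrightarrow> c n k = 0"
      and c: "\<And>n. p n \<gamma> = log_comb (c n) \<gamma>" by metis
    have p: "p n \<alpha> = log_comb (c n) \<alpha>" for n \<alpha>
    proof -
      have "p n \<alpha> = skip_ser \<alpha> \<gamma> (p n \<gamma>)" using * \<gamma> by simp
      also have "\<dots> = log_comb (c n) \<alpha>"
        using deg by (subst c, subst skip_ser_log_comb[OF \<gamma>]) (auto simp: degree_bounded_def)
      finally show ?thesis .
    qed
    \<comment> \<open>Order \<open>\<gamma>\<close> turns (ii) into \<open>binomial_law\<close>, and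
      order zero together with (i) supplies the entries with \<open>k \<ge> 0\<close>.\<close>
    have cu: "c n k = ?u n k" for n k
    proof (rule binomial_law_unique[OF assms _ deg])
      show "binomial_law q c"
        using * by (intro shift_ser_log_comb_binomial_law(2)[OF deg \<gamma>]) (simp_all only: flip: p)
      show "c n k = ?u n k" if "k \<ge> 0" for n k
        using * that log_comb_0_eq_poly_ser_iff[OF assms, of "c n" n] by (simp only: flip: p) blast
    qed
    have "c = ?u" by (intro ext) (rule cu)
    then show "p = ?p" by (intro ext) (simp add: p)
  qed
qed

end
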